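(* Let $t \in\mathbb{R}\setminus\mathbb{Q}$, let $\mu$ be one-half of Lebesgue measure on the interval $[t,t+1]$, and let $\rho = \mu\times\delta_0 + \delta_0\times\mu$, a Borel probability measure on $\mathbb{R}^2$. Then $\rho$ is not spectral.
   Context: $\delta_0$ is the Dirac measure at $0\in\mathbb{R}$; thus $\int g\,d\rho = \frac12\int_t^{t+1} g(s,0)\,ds + \frac12\int_t^{t+1} g(0,s)\,ds$. For $\lambda\in\mathbb{R}^2$ write $e_\lambda(x)=e^{2\pi i\lambda\cdot x}$. A compactly supported Borel probability measure $\nu$ on $\mathbb{R}^2$ is spectral if there is a countable set $\Lambda\subset\mathbb{R}^2$ (called a spectrum of $\nu$) such that the family $(e_\lambda)_{\lambda\in\Lambda}$ is an orthogonal basis of $L^2(\nu)$ (i.e. $e_\lambda$, $e_{\lambda'}$ are orthogonal in $L^2(\nu)$ for distinct $\lambda,\lambda'\in\Lambda$, and the linear span is dense). *)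

theory Defs
  imports "HOL-Probability.Probability"
begin

definition expo :: "'a::euclidean_space \<Rightarrow> 'a \<Rightarrow> complex" where
  "expo \<xi> x = exp (2 * complex_of_real pi * \<i> * complex_of_real (\<xi> \<bullet> x))"

definition L2_functions :: "'a measure \<Rightarrow> ('a \<Rightarrow> complex) set" where
  "L2_functions M = {f \<in> borel_measurable M. integrable M (\<lambda>x. (cmod (f x))\<^sup>2)}"

definition L2_inner :: "'a measure \<Rightarrow> ('a \<Rightarrow> complex) \<Rightarrow> ('a \<Rightarrow> complex) \<Rightarrow> complex" where
  "L2_inner M f g = (\<integral>x. f x * cnj (g x) \<partial>M)"

definition L2_seminorm :: "'a measure \<Rightarrow> ('a \<Rightarrow> complex) \<Rightarrow> real" where
  "L2_seminorm M f = sqrt (\<integral>x. (cmod (f x))\<^sup>2 \<partial>M)"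

definition orthogonal_exponentials :: "'a::euclidean_space measure \<Rightarrow> 'a set \<Rightarrow> bool" where
  "orthogonal_exponentials \<nu> \<Lambda> \<longleftrightarrow>
     (\<forall>\<xi>\<in>\<Lambda>. \<forall>\<eta>\<in>\<Lambda>. \<xi> \<noteq> \<eta> \<longrightarrow> L2_inner \<nu> (expo \<xi>) (expo \<eta>) = 0)"

text \<open>Functions are not identified almost everywhere; density of the linear span of the
  exponentials is stated with the seminorm on representatives.\<close>

definition exponential_span_dense :: "'a::euclidean_space measure \<Rightarrow> 'a set \<Rightarrow> bool" where
  "exponential_span_dense \<nu> \<Lambda> \<longleftrightarrow>
     (\<forall>f\<in>L2_functions \<nu>. \<forall>\<epsilon>>0. \<exists>S c. finite S \<and> S \<subseteq> \<Lambda> \<and>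
        L2_seminorm \<nu> (\<lambda>x. f x - (\<Sum>\<xi>\<in>S. c \<xi> * expo \<xi> x)) < \<epsilon>)"

definition is_spectrum :: "'a::euclidean_space measure \<Rightarrow> 'a set \<Rightarrow> bool" where
  "is_spectrum \<nu> \<Lambda> \<longleftrightarrow>
     countable \<Lambda> \<and> orthogonal_exponentials \<nu> \<Lambda> \<and> exponential_span_dense \<nu> \<Lambda>"

text \<open>The notion is meant for compactly supported Borel probability measures.  These
  requirements are deliberately not conjuncts of the definition, so that a measure cannot fail to
  be spectral merely by violating them; for the measure \<open>rho\<close> below they are proved.\<close>

definition spectral :: "'a::euclidean_space measure \<Rightarrow> bool" where
  "spectral \<nu> \<longleftrightarrow> (\<exists>\<Lambda>. is_spectrum \<nu> \<Lambda>)"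

definition add_measure :: "'a measure \<Rightarrow> 'a measure \<Rightarrow> 'a measure" where
  "add_measure M N = measure_of (space M) (sets M) (\<lambda>A. emeasure M A + emeasure N A)"

definition half_lebesgue :: "real \<Rightarrow> real measure" where
  "half_lebesgue t = scale_measure (1/2) (density lborel (indicator {t..t+1}))"

definition rho :: "real \<Rightarrow> (real \<times> real) measure" where
  "rho t = add_measure (half_lebesgue t \<Otimes>\<^sub>M return borel 0) (return borel 0 \<Otimes>\<^sub>M half_lebesgue t)"

lemma space_add_measure [simp]: "space (add_measure M N) = space M"
  by (simp add: add_measure_def)

lemma sets_add_measure [simp, measurable_cong]: "sets (add_measure M N) = sets M"
  by (simp add: add_measure_def sets.sets_measure_of_eq)

lemma emeasure_add_measure:
  assumes "sets N = sets M" "A \<in> sets M"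
  shows "emeasure (add_measure M N) A = emeasure M A + emeasure N A"
proof (rule emeasure_measure_of[OF add_measure_def])
  show "countably_additive (sets (add_measure M N)) (\<lambda>A. emeasure M A + emeasure N A)"
  proof (rule countably_additiveI)
    fix F :: "nat \<Rightarrow> 'a set"
    assume F: "range F \<subseteq> sets (add_measure M N)" "disjoint_family F"
    have "(\<Sum>i. emeasure M (F i) + emeasure N (F i))
        = (\<Sum>i. emeasure M (F i)) + (\<Sum>i. emeasure N (F i))"
      by (rule suminf_add[symmetric]) auto
    then show "(\<Sum>i. emeasure M (F i) + emeasure N (F i))
        = emeasure M (\<Union>i. F i) + emeasure N (\<Union>i. F i)"
      using F assms(1) by (simp add: suminf_emeasure)
  qed
qed (use assms in \<open>auto simp: positive_def dest: sets.sets_into_space\<close>)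

lemma nn_integral_add_measure:
  assumes N: "sets N = sets M" and f: "f \<in> borel_measurable M"
  shows "(\<integral>\<^sup>+x. f x \<partial>add_measure M N) = (\<integral>\<^sup>+x. f x \<partial>M) + (\<integral>\<^sup>+x. f x \<partial>N)"
  using f
proof (induction rule: borel_measurable_induct)
  case (cong f g)
  have "space N = space M" using N by (rule sets_eq_imp_space_eq)
  have "integral\<^sup>N (add_measure M N) f = integral\<^sup>N (add_measure M N) g"
     "integral\<^sup>N M f = integral\<^sup>N M g" "integral\<^sup>N N f = integral\<^sup>N N g"
    by (rule nn_integral_cong, use cong \<open>space N = space M\<close> in simp)+
  with cong show ?case by simp
next
  case (set A)
  then show ?case using N by (simp add: emeasure_add_measure)
next
  case (mult u c)
  have [measurable]: "u \<in> borel_measurable N" "u \<in> borel_measurable (add_measure M N)"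
    using mult N by (simp_all cong: measurable_cong_sets)
  show ?case using mult by (simp add: nn_integral_cmult distrib_left)
next
  case (add u v)
  have [measurable]: "u \<in> borel_measurable N" "v \<in> borel_measurable N"
     "u \<in> borel_measurable (add_measure M N)" "v \<in> borel_measurable (add_measure M N)"
    using add N by (simp_all cong: measurable_cong_sets)
  show ?case using add by (simp add: nn_integral_add ac_simps)
next
  case (seq U)
  have m: "U i \<in> borel_measurable N" "U i \<in> borel_measurable (add_measure M N)" for i
    using seq N by (simp_all cong: measurable_cong_sets)
  have inc: "incseq (\<lambda>i. integral\<^sup>N M (U i))" for M :: "'a measure"
    using seq by (auto simp: incseq_def le_fun_def intro!: nn_integral_mono)
  have "(\<integral>\<^sup>+x. (SUP i. U i) x \<partial>add_measure M N) = (SUP i. integral\<^sup>N (add_measure M N) (U i))"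
    using seq m by (simp add: nn_integral_monotone_convergence_SUP image_comp)
  also have "\<dots> = (SUP i. integral\<^sup>N M (U i) + integral\<^sup>N N (U i))"
    using seq by simp
  also have "\<dots> = (SUP i. integral\<^sup>N M (U i)) + (SUP i. integral\<^sup>N N (U i))"
    by (rule ennreal_SUP_add) (rule inc)+
  also have "\<dots> = (\<integral>\<^sup>+x. (SUP i. U i) x \<partial>M) + (\<integral>\<^sup>+x. (SUP i. U i) x \<partial>N)"
    using seq m by (simp add: nn_integral_monotone_convergence_SUP image_comp)
  finally show ?case .
qed

lemma sets_half_lebesgue [simp, measurable_cong]: "sets (half_lebesgue t) = sets borel"
  by (simp add: half_lebesgue_def)

lemma nn_integral_half_lebesgue:
  assumes [measurable]: "g \<in> borel_measurable borel"
  shows "(\<integral>\<^sup>+s. g s \<partial>half_lebesgue t) = (1/2) * (\<integral>\<^sup>+s\<in>{t..t+1}. g s \<partial>lborel)"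
  by (simp add: half_lebesgue_def nn_integral_scale_measure nn_integral_density mult.commute)

lemma emeasure_half_lebesgue_UNIV: "emeasure (half_lebesgue t) UNIV = 1/2"
  by (simp add: half_lebesgue_def emeasure_density)

lemma sigma_finite_half_lebesgue: "sigma_finite_measure (half_lebesgue t)"
proof -
  have "space (half_lebesgue t) = UNIV" 
    using sets_eq_imp_space_eq[OF sets_half_lebesgue] by simp
  then have "finite_measure (half_lebesgue t)"
    by (intro finite_measureI) (simp add: emeasure_half_lebesgue_UNIV ennreal_divide_eq_top_iff)
  then show ?thesis by (simp add: finite_measure_def)
qed

lemma sets_rho [simp, measurable_cong]: "sets (rho t) = sets borel"
proof -
  have "sets (half_lebesgue t \<Otimes>\<^sub>M return borel (0::real)) = sets (borel \<Otimes>\<^sub>M borel)"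
    by (intro sets_pair_measure_cong; simp)
  also have "\<dots> = sets (borel :: (real \<times> real) measure)"
    by (simp only: borel_prod)
  finally show ?thesis by (simp add: rho_def)
qed

lemma nn_integral_rho:
  fixes g :: "real \<times> real \<Rightarrow> ennreal"
  assumes [measurable]: "g \<in> borel_measurable borel"
  shows "(\<integral>\<^sup>+x. g x \<partial>rho t)
    = (1/2) * (\<integral>\<^sup>+s\<in>{t..t+1}. g (s, 0) \<partial>lborel) + (1/2) * (\<integral>\<^sup>+s\<in>{t..t+1}. g (0, s) \<partial>lborel)"
proof -
  interpret H: sigma_finite_measure "half_lebesgue t" by (rule sigma_finite_half_lebesgue)
  interpret R: prob_space "return borel (0::real)" by (rule prob_space_return) simp
  have g': "g \<in> borel_measurable (borel \<Otimes>\<^sub>M borel)" by (simp add: borel_prod)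
  have s1: "sets (half_lebesgue t \<Otimes>\<^sub>M return borel (0::real)) = sets (borel \<Otimes>\<^sub>M borel)"
   and s2: "sets (return borel (0::real) \<Otimes>\<^sub>M half_lebesgue t) = sets (borel \<Otimes>\<^sub>M borel)"
    by (intro sets_pair_measure_cong; simp)+
  have g1: "g \<in> borel_measurable (half_lebesgue t \<Otimes>\<^sub>M return borel 0)"
   and g2: "g \<in> borel_measurable (return borel 0 \<Otimes>\<^sub>M half_lebesgue t)"
    using g' s1 s2 by (simp_all cong: measurable_cong_sets)
  have m1: "(\<lambda>s. g (s, x)) \<in> borel_measurable borel" for x
    by (rule measurable_compose[OF _ assms]) measurable
  have m2: "(\<lambda>s. g (x, s)) \<in> borel_measurable borel" for x
    by (rule measurable_compose[OF _ assms]) measurable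
  have m3: "(\<lambda>x. \<integral>\<^sup>+s. g (x, s) \<partial>half_lebesgue t) \<in> borel_measurable borel"
    using H.borel_measurable_nn_integral_fst[OF g2] by (simp cong: measurable_cong_sets)
  have "(\<integral>\<^sup>+x. g x \<partial>(half_lebesgue t \<Otimes>\<^sub>M return borel 0)) = (\<integral>\<^sup>+s. g (s, 0) \<partial>half_lebesgue t)"
    by (subst R.nn_integral_fst[symmetric, OF g1]) (simp add: nn_integral_return m2)
  moreover have "(\<integral>\<^sup>+x. g x \<partial>(return borel 0 \<Otimes>\<^sub>M half_lebesgue t)) = (\<integral>\<^sup>+s. g (0, s) \<partial>half_lebesgue t)"
    by (subst H.nn_integral_fst[symmetric, OF g2]) (simp add: nn_integral_return m3)
  ultimately show ?thesis
    unfolding rho_def using s1 s2 g1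
    by (simp add: nn_integral_add_measure nn_integral_half_lebesgue m1 m2)
qed

lemma ennreal_half_add_half: "(1/2 :: ennreal) + 1/2 = 1"
  by (simp add: ennreal_divide_self flip: add_divide_distrib_ennreal)

lemma prob_space_rho: "prob_space (rho t)"
proof
  have "space (rho t) = UNIV" using sets_eq_imp_space_eq[OF sets_rho] by simp
  then have "emeasure (rho t) (space (rho t)) = (\<integral>\<^sup>+x. 1 \<partial>rho t)" by simp
  also have "\<dots> = 1/2 + 1/2" by (subst nn_integral_rho) simp_all
  also have "\<dots> = 1" by (rule ennreal_half_add_half)
  finally show "emeasure (rho t) (space (rho t)) = 1" .
qed

lemma compact_support_rho: "\<exists>K. compact K \<and> emeasure (rho t) (- K) = 0"
proof (intro exI conjI)
  let ?K = "({t..t+1} \<times> {0}) \<union> ({0} \<times> {t..t+1})"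
  show K: "compact ?K" by (intro compact_Un compact_Times) auto
  then have K': "- ?K \<in> sets borel" by (intro borel_comp borel_compact)
  have "emeasure (rho t) (- ?K) = (\<integral>\<^sup>+x. indicator (- ?K) x \<partial>rho t)"
    using K' by (subst nn_integral_indicator) auto
  also have "\<dots> = 0"
  proof (subst nn_integral_rho)
    have "(\<integral>\<^sup>+s\<in>{t..t+1}. indicator (- ?K) (s, 0) \<partial>lborel) = (\<integral>\<^sup>+(s::real). 0 \<partial>lborel)"
      by (intro nn_integral_cong) (auto simp: indicator_def)
    moreover have "(\<integral>\<^sup>+s\<in>{t..t+1}. indicator (- ?K) (0, s) \<partial>lborel) = (\<integral>\<^sup>+(s::real). 0 \<partial>lborel)"
      by (intro nn_integral_cong) (auto simp: indicator_def)
    ultimately show "(1/2) * (\<integral>\<^sup>+s\<in>{t..t+1}. indicator (- ?K) (s, 0) \<partial>lborel)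
      + (1/2) * (\<integral>\<^sup>+s\<in>{t..t+1}. indicator (- ?K) (0, s) \<partial>lborel) = (0::ennreal)" by simp
  qed (use K' in simp)
  finally show "emeasure (rho t) (- ?K) = 0" .
qed

end

theory Submission
  imports Defs "HOL-Real_Asymp.Real_Asymp"
begin

text \<open>
  Let \<open>c = 2 * t + 1\<close> and let \<open>nsinc\<close> be the normalised sinc function. Up to a factor \<open>1/2\<close>, the
  Fourier transform of the measure at \<open>(a, b)\<close> is
  \<open>cis (pi * c * a) * nsinc a + cis (pi * c * b) * nsinc b\<close>. Its zeros other than pairs of nonzero
  integers satisfy \<open>c * (a - b) \<in> \<int>\<close> and \<open>\<bar>nsinc a\<bar> = \<bar>nsinc b\<bar> \<noteq> 0\<close>. Completeness, tested on functions
  supported on the first axis, gives \<open>\<Sum> (nsinc (x - \<eta>\<^sub>1))\<^sup>2 = 2\<close> for all \<open>x\<close>, the sum being over \<open>\<eta>\<close> in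
  the spectrum. Since \<open>c\<close> is irrational, this excludes integer differences altogether.

  Attach to a point \<open>\<xi>\<close> of the spectrum the unit vectors \<open>u\<close>, with angle \<open>pi * \<xi>\<^sub>1\<close>, and \<open>v\<close>, with angle
  \<open>pi * \<xi>\<^sub>2\<close> and a suitable sign. Orthogonality of \<open>\<xi>\<close> and \<open>\<mu>\<close> becomes a linear relation between the
  areas \<open>det (u\<^sub>\<xi>, u\<^sub>\<mu>)\<close> and \<open>det (v\<^sub>\<xi>, v\<^sub>\<mu>)\<close> with coefficients \<open>\<xi>\<^sub>2 - \<mu>\<^sub>2\<close> and \<open>\<xi>\<^sub>1 - \<mu>\<^sub>1\<close>. Letting \<open>\<xi>\<close>
  tend to infinity yields linear equations between \<open>u\<^sub>\<mu>\<close> and \<open>v\<^sub>\<mu>\<close> that hold for all \<open>\<mu>\<close>. If the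
  vectors \<open>u\<close> have two non-parallel limits, then \<open>u\<close> is a linear image of \<open>v\<close>; the map must be
  orthogonal, all differences are of the form \<open>(a, -a)\<close> with sign product \<open>-1\<close>, and three points are
  contradictory. If there is only one limit direction, the first coordinates are asymptotically
  congruent modulo \<open>1\<close>; as they are also uniformly separated, the above sum at a far point of the
  spectrum is close to \<open>1\<close> instead of \<open>2\<close>.
\<close>

section \<open>The normalised sinc function\<close>

definition nsinc :: "real \<Rightarrow> real" where
  "nsinc x = (if x = 0 then 1 else sin (pi * x) / (pi * x))"

lemma nsinc_0 [simp]: "nsinc 0 = 1"
  by (simp add: nsinc_def)

lemma nsinc_minus [simp]: "nsinc (- x) = nsinc x"
  by (simp add: nsinc_def)

lemma nsinc_eq_0_iff: "nsinc x = 0 \<longleftrightarrow> x \<in> \<int> \<and> x \<noteq> 0"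
  using sin_times_pi_eq_0[of x] by (simp add: nsinc_def mult.commute)

lemma power2_nsinc_le: "x \<noteq> 0 \<Longrightarrow> (nsinc x)\<^sup>2 \<le> 1 / (pi * x)\<^sup>2"
  using abs_sin_le_one[of "pi * x"]
  by (simp add: nsinc_def power_divide divide_right_mono abs_square_le_1)

lemma isCont_nsinc: "isCont nsinc x"
proof -
  have "isCont (\<lambda>x. sinc (pi * x)) x"
    by (rule isCont_o2[OF _ isCont_sinc]) (intro continuous_intros)
  also have "(\<lambda>x. sinc (pi * x)) = nsinc"
    by (auto simp: nsinc_def fun_eq_iff)
  finally show ?thesis .
qed

text \<open>With \<open>y = pi * x\<close>, the quotient \<open>\<bar>sin y\<bar> / y\<close> is at
  most 1/2 once \<open>y \<ge> 2\<close>. For smaller \<open>y\<close> the duplication formula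
  bounds it by \<open>cos (y/2)\<close>, which decreases in \<open>y\<close>. The bound serves to
  separate the points of the spectrum and to compare sinc values with 1.\<close>

lemma nsinc_bounded_away:
  assumes "\<beta> > 0"
  obtains m where "m < 1" "\<And>x. \<bar>x\<bar> \<ge> \<beta> \<Longrightarrow> \<bar>nsinc x\<bar> \<le> m"
proof -
  define b where "b = min (pi * \<beta>) 2"
  have b: "0 < b" "b \<le> 2" "b \<le> pi * \<beta>" using assms by (auto simp: b_def)
  have "cos (b / 2) < cos 0"
    using b pi_gt3 by (intro cos_monotone_0_pi) auto
  then have lt: "max (1/2) (cos (b / 2)) < 1" by simp
  have pos: "\<bar>nsinc x\<bar> \<le> max (1/2) (cos (b / 2))" if "x \<ge> \<beta>" for x
  proof -
    define y where "y = pi * x"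
    have "pi * \<beta> \<le> pi * x" using that by (intro mult_left_mono) auto
    with b have y: "b \<le> y" "0 < y" unfolding y_def by linarith+
    have ns: "\<bar>nsinc x\<bar> = \<bar>sin y\<bar> / y" using y by (auto simp: nsinc_def y_def)
    show ?thesis
    proof (cases "y \<ge> 2")
      case True
      have "\<bar>sin y\<bar> / y \<le> 1 / 2" using True abs_sin_le_one[of y] by (intro frac_le) auto
      then show ?thesis unfolding ns by (rule max.coboundedI1)
    next
      case False
      have "\<bar>sin y\<bar> = 2 * \<bar>sin (y/2)\<bar> * \<bar>cos (y/2)\<bar>"
        using sin_double[of "y/2"] by (simp add: abs_mult)
      also have "\<dots> \<le> y * \<bar>cos (y/2)\<bar>"
        using abs_sin_x_le_abs_x[of "y/2"] y by (intro mult_right_mono) auto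
      also have "\<bar>cos (y/2)\<bar> = cos (y/2)"
        using False y pi_gt3 by (intro abs_of_nonneg cos_ge_zero) auto
      also have "cos (y/2) \<le> cos (b/2)"
        using False y pi_gt3 b by (intro cos_monotone_0_pi_le) auto
      finally have "\<bar>sin y\<bar> / y \<le> cos (b/2)" using y by (simp add: field_simps)
      then show ?thesis unfolding ns by (rule max.coboundedI2)
    qed
  qed
  have "\<bar>nsinc x\<bar> \<le> max (1/2) (cos (b / 2))" if "\<bar>x\<bar> \<ge> \<beta>" for x
    using pos[of "\<bar>x\<bar>"] that by (cases "x \<ge> 0") auto
  with lt that show thesis by blast
qed

text \<open>Removing the nearest integer changes \<open>sin (pi * x)\<close> at most by a sign. On
  the remaining interval the cubic remainder of the Taylor formula leaves at least half of the
  linear term.\<close>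

lemma dist_round_le_abs_sin: "\<bar>x - of_int (round x)\<bar> \<le> \<bar>sin (pi * x)\<bar>"
proof -
  define r where "r = x - of_int (round x)"
  define y where "y = pi * r"
  have r: "\<bar>r\<bar> \<le> 1/2" using of_int_round_abs_le[of x] by (simp add: r_def abs_minus_commute)
  have "pi * x = y + of_int (round x) * pi" by (simp add: y_def r_def algebra_simps)
  then have "\<bar>sin (pi * x)\<bar> = \<bar>sin y\<bar>"
    using sin_zero_iff_int2[of "of_int (round x) * pi"] sin_zero_abs_cos_one[of "of_int (round x) * pi"]
    by (auto simp: sin_add abs_mult)
  moreover have "\<bar>r\<bar> \<le> \<bar>sin y\<bar>"
  proof -
    have "\<bar>y\<bar> \<le> 8/5" using r pi_less_4 mult_mono[of pi "16/5" "\<bar>r\<bar>" "1/2"] pi_approx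
      by (simp add: y_def abs_mult)
    \<comment> \<open>The value 3 is what turns the remainder
      \<open>\<bar>y\<bar> * y\<^sup>2 / 6\<close> into at most
      \<open>\<bar>y\<bar> / 2\<close>.\<close>
    then have y2: "y\<^sup>2 \<le> 3" using power_mono[of "\<bar>y\<bar>" "8/5" 2] by (simp add: power2_eq_square)
    have "\<bar>sin y - (\<Sum>m<3. sin_coeff m * y ^ m)\<bar> \<le> inverse (fact 3) * \<bar>y\<bar> ^ 3"
      by (rule Maclaurin_sin_bound)
    moreover have "(\<Sum>m<3. sin_coeff m * y ^ m) = y"
      by (simp add: eval_nat_numeral sin_coeff_def)
    ultimately have "\<bar>sin y - y\<bar> \<le> \<bar>y\<bar> * y\<^sup>2 / 6"
      by (simp add: eval_nat_numeral power2_eq_square field_simps)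
    also have "\<dots> \<le> \<bar>y\<bar> / 2" using mult_left_mono[OF y2, of "\<bar>y\<bar>"] by simp
    finally have "\<bar>sin y\<bar> \<ge> \<bar>y\<bar> / 2" by linarith
    moreover have "\<bar>y\<bar> / 2 \<ge> \<bar>r\<bar>" using pi_gt3 mult_right_mono[of 2 pi "\<bar>r\<bar>"] 
      by (simp add: y_def abs_mult)
    ultimately show ?thesis by linarith
  qed
  ultimately show ?thesis by (simp add: r_def)
qed

section \<open>Square sums of sinc values\<close>

lemma sum_inverse_power2_int_le:
  assumes "finite N" "(0::int) \<notin> N"
  shows "(\<Sum>n\<in>N. 1 / (real_of_int n)\<^sup>2) \<le> 2 * (\<Sum>k. inverse (real k ^ 2))"
proof -
  have le: "(\<Sum>n\<in>M. 1 / (real_of_int n)\<^sup>2) \<le> (\<Sum>k. inverse (real k ^ 2))"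
    if "finite M" "inj_on (\<lambda>n. nat \<bar>n\<bar>) M" for M
  proof -
    \<comment> \<open>The series on the right also has an index \<open>k = 0\<close>; its term is
      \<open>inverse 0 = 0\<close>. Positive and negative integers are treated apart because
      \<open>\<bar>n\<bar>\<close> determines \<open>n\<close> only on each half.\<close>
    have "(\<Sum>n\<in>M. 1 / (real_of_int n)\<^sup>2) = (\<Sum>k\<in>(\<lambda>n. nat \<bar>n\<bar>) ` M. inverse (real k ^ 2))"
      using that by (simp add: sum.reindex inverse_eq_divide)
    also have "\<dots> \<le> (\<Sum>k. inverse (real k ^ 2))"
      using that by (intro sum_le_suminf inverse_power_summable) auto
    finally show ?thesis .
  qed
  have "N = {n\<in>N. n > 0} \<union> {n\<in>N. n < 0}" using assms linorder_neq_iff by blast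
  then have "(\<Sum>n\<in>N. 1 / (real_of_int n)\<^sup>2)
      = (\<Sum>n\<in>{n\<in>N. n > 0}. 1 / (real_of_int n)\<^sup>2) + (\<Sum>n\<in>{n\<in>N. n < 0}. 1 / (real_of_int n)\<^sup>2)"
    using assms by (metis (no_types, lifting) sum.union_disjoint disjoint_iff finite_Un mem_Collect_eq
        not_less_iff_gr_or_eq)
  also have "\<dots> \<le> 2 * (\<Sum>k. inverse (real k ^ 2))"
    using le[of "{n\<in>N. n > 0}"] le[of "{n\<in>N. n < 0}"] assms by (force simp: inj_on_def)
  finally show ?thesis .
qed

text \<open>Each \<open>a\<close> lies within \<open>\<epsilon>\<close> of an integer. By the
  separation these integers are nonzero and distinct, so the sum is dominated by
  \<open>\<epsilon>\<^sup>2\<close> times the sum of the inverse squares. The constant depends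
  neither on the set nor on \<open>g\<close>, which permits a choice of \<open>\<epsilon>\<close>
  after \<open>g\<close>.\<close>

lemma sum_nsinc_near_integers:
  obtains C where "C > 0"
    "\<And>F \<epsilon> g. finite F \<Longrightarrow> 2 * \<epsilon> < g \<Longrightarrow> g \<le> 1 \<Longrightarrow> \<forall>a\<in>F. \<bar>sin (pi * a)\<bar> \<le> \<epsilon> \<and> g \<le> \<bar>a\<bar> \<Longrightarrow>
       \<forall>a\<in>F. \<forall>b\<in>F. a \<noteq> b \<longrightarrow> g \<le> \<bar>a - b\<bar> \<Longrightarrow> (\<Sum>a\<in>F. (nsinc a)\<^sup>2) \<le> C * \<epsilon>\<^sup>2"
proof
  let ?C = "1 + 2 * (\<Sum>k. inverse (real k ^ 2))"
  show "?C > 0" using suminf_nonneg[OF inverse_power_summable[of 2, where 'a=real]] by simp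
  fix F :: "real set" and \<epsilon> g :: real
  assume fin: "finite F" and eg: "2 * \<epsilon> < g" "g \<le> 1"
    and near: "\<forall>a\<in>F. \<bar>sin (pi * a)\<bar> \<le> \<epsilon> \<and> g \<le> \<bar>a\<bar>"
    and sep: "\<forall>a\<in>F. \<forall>b\<in>F. a \<noteq> b \<longrightarrow> g \<le> \<bar>a - b\<bar>"
  have d: "\<bar>a - of_int (round a)\<bar> \<le> \<epsilon>" if "a \<in> F" for a
    using near that dist_round_le_abs_sin[of a] by force
  have nz: "round a \<noteq> 0" if "a \<in> F" for a
  proof
    assume "round a = 0"
    with d[OF that] near that eg show False by force
  qed
  have inj: "inj_on round F"
  proof (rule inj_onI, rule ccontr)
    fix a b assume ab: "a \<in> F" "b \<in> F" "round a = round b" "a \<noteq> b"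
    then have "g \<le> \<bar>a - b\<bar>" using sep by blast
    with d[OF ab(1)] d[OF ab(2)] ab(3) eg show False by linarith
  qed
  have le: "(nsinc a)\<^sup>2 \<le> \<epsilon>\<^sup>2 * (1 / (real_of_int (round a))\<^sup>2)" if a: "a \<in> F" for a
  proof -
    have n1: "1 \<le> \<bar>real_of_int (round a)\<bar>" using nz[OF a] by linarith
    \<comment> \<open>The rounding error is at most \<open>\<epsilon> < g / 2 \<le> 1 / 2\<close>,
      hence at most half of \<open>\<bar>round a\<bar>\<close>.\<close>
    have a2: "\<bar>real_of_int (round a)\<bar> \<le> 2 * \<bar>a\<bar>" using d[OF a] eg n1 by linarith
    have a0: "a \<noteq> 0" using near a eg d[OF a] by force
    have "\<bar>real_of_int (round a)\<bar> \<le> \<bar>pi * a\<bar>"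
      using a2 pi_gt3 mult_right_mono[of 2 pi "\<bar>a\<bar>"] by (simp add: abs_mult)
    then have "\<bar>nsinc a\<bar> \<le> \<epsilon> / \<bar>real_of_int (round a)\<bar>"
      using near a n1 a0 unfolding nsinc_def by (simp del: of_int_abs add: abs_divide) (intro frac_le; force)
    from power_mono[OF this, of 2] show ?thesis by (simp add: power_divide)
  qed
  have "(\<Sum>a\<in>F. (nsinc a)\<^sup>2) \<le> \<epsilon>\<^sup>2 * (\<Sum>a\<in>F. 1 / (real_of_int (round a))\<^sup>2)"
    using sum_mono[OF le] by (simp add: sum_distrib_left)
  also have "(\<Sum>a\<in>F. 1 / (real_of_int (round a))\<^sup>2) = (\<Sum>n\<in>round ` F. 1 / (real_of_int n)\<^sup>2)"
    using inj by (simp add: sum.reindex)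
  also have "\<dots> \<le> 2 * (\<Sum>k. inverse (real k ^ 2))"
    using fin nz by (intro sum_inverse_power2_int_le) force+
  also have "\<dots> \<le> ?C" by simp
  finally show "(\<Sum>a\<in>F. (nsinc a)\<^sup>2) \<le> ?C * \<epsilon>\<^sup>2"
    by (simp only: mult.commute[of ?C] mult_left_mono zero_le_power2)
qed

text \<open>A finite sum of terms decaying like an inverse square. It makes a finite exceptional set
  negligible at far points.\<close>

lemma sum_nsinc_far:
  assumes "finite E" "\<delta> > 0"
  obtains M where "\<And>x. \<bar>x\<bar> \<ge> M \<Longrightarrow> (\<Sum>\<mu>\<in>E. (nsinc (x - p \<mu>))\<^sup>2) \<le> \<delta>"
proof -
  have "((\<lambda>x. \<Sum>\<mu>\<in>E. (nsinc (x - p \<mu>))\<^sup>2) \<longlongrightarrow> (\<Sum>\<mu>\<in>E. 0)) at_infinity"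
  proof (intro tendsto_sum)
    fix \<mu>
    have lim: "((\<lambda>x::real. 1 / (pi * (x - p \<mu>))\<^sup>2) \<longlongrightarrow> 0) at_infinity"
      unfolding at_infinity_eq_at_top_bot by (rule filterlim_sup; real_asymp)
    \<comment> \<open>At \<open>x = p \<mu>\<close> the comparison fails, since the quotient is 0 by
      division by zero while \<open>nsinc\<close> is 1.\<close>
    have ne: "eventually (\<lambda>x. x \<noteq> p \<mu>) at_infinity"
      unfolding eventually_at_infinity by (rule exI[of _ "\<bar>p \<mu>\<bar> + 1"]) auto
    show "((\<lambda>x. (nsinc (x - p \<mu>))\<^sup>2) \<longlongrightarrow> 0) at_infinity"
      by (rule tendsto_sandwich[OF _ _ tendsto_const lim])
         (auto intro!: eventually_mono[OF ne] power2_nsinc_le)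
  qed
  then have "eventually (\<lambda>x. (\<Sum>\<mu>\<in>E. (nsinc (x - p \<mu>))\<^sup>2) < \<delta>) at_infinity"
    using assms(2) by (auto dest: order_tendstoD)
  then obtain M where M: "\<And>x. \<bar>x\<bar> \<ge> M \<Longrightarrow> (\<Sum>\<mu>\<in>E. (nsinc (x - p \<mu>))\<^sup>2) < \<delta>"
    by (auto simp: eventually_at_infinity)
  show thesis by (rule that[of M]) (use M in force)
qed

section \<open>Sets with generic differences\<close>

text \<open>The properties of a spectrum that remain once integer differences are excluded. For a
  difference \<open>(a, b)\<close> the sign \<open>cos (pi * (c * (a - b)))\<close> is written as
  the product \<open>sg \<xi> * sg \<mu>\<close>, so that each sign can be absorbed into the vector
  of one point. Assumption \<open>rel\<close> is
  \<open>nsinc a + sg \<xi> * sg \<mu> * nsinc b = 0\<close> multiplied by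
  \<open>pi * a * b\<close>.\<close>

locale twisted_set =
  fixes L :: "(real \<times> real) set" and c :: real and sg :: "real \<times> real \<Rightarrow> real"
  assumes c_nonzero: "c \<noteq> 0"
    and sg: "\<xi> \<in> L \<Longrightarrow> (sg \<xi>)\<^sup>2 = 1"
    and nonint_fst: "\<xi> \<in> L \<Longrightarrow> \<mu> \<in> L \<Longrightarrow> \<xi> \<noteq> \<mu> \<Longrightarrow> fst \<xi> - fst \<mu> \<notin> \<int>"
    and nonint_snd: "\<xi> \<in> L \<Longrightarrow> \<mu> \<in> L \<Longrightarrow> \<xi> \<noteq> \<mu> \<Longrightarrow> snd \<xi> - snd \<mu> \<notin> \<int>"
    and diff_neq: "\<xi> \<in> L \<Longrightarrow> \<mu> \<in> L \<Longrightarrow> \<xi> \<noteq> \<mu> \<Longrightarrow> fst \<xi> - fst \<mu> \<noteq> snd \<xi> - snd \<mu>"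
    and diff_int: "\<xi> \<in> L \<Longrightarrow> \<mu> \<in> L \<Longrightarrow> c * ((fst \<xi> - fst \<mu>) - (snd \<xi> - snd \<mu>)) \<in> \<int>"
    and rel: "\<xi> \<in> L \<Longrightarrow> \<mu> \<in> L \<Longrightarrow>
      (snd \<xi> - snd \<mu>) * sin (pi * (fst \<xi> - fst \<mu>))
        + sg \<xi> * sg \<mu> * ((fst \<xi> - fst \<mu>) * sin (pi * (snd \<xi> - snd \<mu>))) = 0"
begin

lemma abs_sg: "\<xi> \<in> L \<Longrightarrow> \<bar>sg \<xi>\<bar> = 1"
  using sg[of \<xi>] by (simp add: abs_square_eq_1)

text \<open>If \<open>a\<close> is close to 0, then \<open>\<bar>nsinc a\<bar>\<close> is close to
  1. But \<open>c * (a - b)\<close> is a nonzero integer, which keeps \<open>b\<close> away from 0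
  and \<open>\<bar>nsinc b\<bar>\<close> away from 1, although the two absolute values
  agree.\<close>

lemma gap:
  obtains g where "0 < g" "g \<le> 1"
    "\<And>\<xi> \<mu>. \<xi> \<in> L \<Longrightarrow> \<mu> \<in> L \<Longrightarrow> \<xi> \<noteq> \<mu> \<Longrightarrow> g \<le> \<bar>fst \<xi> - fst \<mu>\<bar>"
proof -
  \<comment> \<open>Half of the least possible distance \<open>1 / \<bar>c\<bar>\<close> between
    \<open>a\<close> and \<open>b\<close>: \<open>\<bar>a\<bar> < \<beta>\<close> then forces
    \<open>\<bar>b\<bar> \<ge> \<beta>\<close>.\<close>
  define \<beta> where "\<beta> = 1 / (2 * \<bar>c\<bar>)"
  have \<beta>: "\<beta> > 0" using c_nonzero by (simp add: \<beta>_def)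
  obtain m where m: "m < 1" "\<And>x. \<bar>x\<bar> \<ge> \<beta> \<Longrightarrow> \<bar>nsinc x\<bar> \<le> m"
    using nsinc_bounded_away[OF \<beta>] by blast
  have "(nsinc \<longlongrightarrow> 1) (at 0)"
    using isCont_nsinc[of 0] by (simp add: isCont_def)
  then have "eventually (\<lambda>x. nsinc x > m) (at 0)"
    using m(1) by (rule order_tendstoD)
  then obtain d where d: "d > 0" "\<And>x. x \<noteq> 0 \<Longrightarrow> \<bar>x\<bar> < d \<Longrightarrow> nsinc x > m"
    by (auto simp: eventually_at dist_real_def)
  define g where "g = min 1 (min d \<beta>)"
  show thesis
  proof
    show "0 < g" "g \<le> 1" using d \<beta> by (auto simp: g_def)
    fix \<xi> \<mu> assume lm: "\<xi> \<in> L" "\<mu> \<in> L" "\<xi> \<noteq> \<mu>"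
    define a b where "a = fst \<xi> - fst \<mu>" and "b = snd \<xi> - snd \<mu>"
    have ab: "a \<notin> \<int>" "b \<notin> \<int>" "a \<noteq> b" "c * (a - b) \<in> \<int>"
      using nonint_fst[OF lm] nonint_snd[OF lm] diff_neq[OF lm] diff_int[OF lm(1,2)]
      by (auto simp: a_def b_def)
    then have ab0: "a \<noteq> 0" "b \<noteq> 0" by auto
    have "b * sin (pi * a) = - (sg \<xi> * sg \<mu> * (a * sin (pi * b)))"
      using rel[OF lm(1,2)] by (simp add: a_def b_def)
    then have "\<bar>b\<bar> * \<bar>sin (pi * a)\<bar> = \<bar>a\<bar> * \<bar>sin (pi * b)\<bar>"
      using abs_sg[OF lm(1)] abs_sg[OF lm(2)] by (metis abs_minus_cancel abs_mult mult_1)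
    then have eq: "\<bar>nsinc a\<bar> = \<bar>nsinc b\<bar>"
      using ab0 by (simp add: nsinc_def abs_mult field_simps)
    have "\<bar>c * (a - b)\<bar> \<ge> 1" using ab c_nonzero by (intro Ints_nonzero_abs_ge1) auto
    then have "\<bar>a - b\<bar> \<ge> 2 * \<beta>" using c_nonzero by (simp add: \<beta>_def abs_mult divide_simps mult.commute)
    show "g \<le> \<bar>fst \<xi> - fst \<mu>\<bar>"
    proof (rule ccontr)
      assume "\<not> ?thesis"
      then have "\<bar>a\<bar> < d" "\<bar>a\<bar> < \<beta>" by (auto simp: g_def a_def)
      then have "\<bar>b\<bar> \<ge> \<beta>" "nsinc a > m" using \<open>\<bar>a - b\<bar> \<ge> 2 * \<beta>\<close> d ab0 by auto
      then show False using m(2)[of b] eq by auto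
    qed
  qed
qed

text \<open>Separation of first coordinates makes the cell index
  \<open>\<lfloor>fst \<xi> / g\<rfloor>\<close> injective, so even an unbounded vertical strip
  contains finitely many points.\<close>

lemma finite_bounded_part: "finite {\<xi> \<in> L. \<bar>fst \<xi>\<bar> \<le> M}"
proof -
  obtain g where g: "0 < g" "g \<le> 1"
    "\<And>\<xi> \<mu>. \<xi> \<in> L \<Longrightarrow> \<mu> \<in> L \<Longrightarrow> \<xi> \<noteq> \<mu> \<Longrightarrow> g \<le> \<bar>fst \<xi> - fst \<mu>\<bar>" by (rule gap) blast
  let ?A = "{\<xi> \<in> L. \<bar>fst \<xi>\<bar> \<le> M}" and ?f = "\<lambda>\<xi>::real \<times> real. \<lfloor>fst \<xi> / g\<rfloor>"
  have "inj_on ?f ?A"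
  proof (rule inj_onI, rule ccontr)
    fix \<xi> \<mu> assume *: "\<xi> \<in> ?A" "\<mu> \<in> ?A" "?f \<xi> = ?f \<mu>" "\<xi> \<noteq> \<mu>"
    then have "\<bar>fst \<xi> / g - fst \<mu> / g\<bar> < 1" by linarith
    then have "\<bar>fst \<xi> - fst \<mu>\<bar> < g" using g(1) by (simp add: divide_less_eq_1 flip: diff_divide_distrib)
    with g(3)[of \<xi> \<mu>] * show False by auto
  qed
  moreover have "?f ` ?A \<subseteq> {\<lfloor>- M / g\<rfloor>..\<lfloor>M / g\<rfloor>}"
    using g(1) by (auto intro!: floor_mono simp: abs_le_iff field_simps)
  ultimately show ?thesis by (meson finite_atLeastAtMost_int inj_on_finite)
qed

text \<open>Assumption \<open>rel\<close> is divided by the size of a point running to infinity in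
  \<open>L'\<close>. Along a subsequence \<open>(p, q)\<close> and \<open>(p', q')\<close> are the
  limits of the unit vectors and \<open>(B, A)\<close> is the limit of the direction of the point.
  The set \<open>L'\<close> is arbitrary so that a second application can start from exceptional
  points, while the equation holds on all of \<open>L\<close>.\<close>

lemma limit_relation:
  assumes "infinite L'" "L' \<subseteq> L"
  obtains A B p q p' q' l where "A \<noteq> 0" "p\<^sup>2 + q\<^sup>2 = 1"
    "\<And>\<mu>. \<mu> \<in> L \<Longrightarrow> A * (q * cos (pi * fst \<mu>) - p * sin (pi * fst \<mu>))
        + B * (sg \<mu> * (q' * cos (pi * snd \<mu>) - p' * sin (pi * snd \<mu>))) = 0"
    "\<And>j::nat. l j \<in> L'"
    "(\<lambda>j. cos (pi * fst (l j))) \<longlonglongrightarrow> p" "(\<lambda>j. sin (pi * fst (l j))) \<longlonglongrightarrow> q"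
proof -
  obtain f :: "nat \<Rightarrow> real \<times> real" where f: "inj f" "range f \<subseteq> L'"
    using assms(1) infinite_countable_subset by blast
  define n where "n = (\<lambda>\<xi>::real \<times> real. \<bar>fst \<xi>\<bar> + \<bar>snd \<xi>\<bar>)"
  \<comment> \<open>Packing the three pairs into one point of a compact box yields a single
    subsequence along which all of them converge.\<close>
  define F where "F = (\<lambda>\<xi>::real \<times> real. ((cos (pi * fst \<xi>), sin (pi * fst \<xi>)),
    (sg \<xi> * cos (pi * snd \<xi>), sg \<xi> * sin (pi * snd \<xi>)), (fst \<xi> / n \<xi>, snd \<xi> / n \<xi>)))"
  let ?I = "{-1..1} \<times> {-1..1::real}"
  have F_in: "F \<xi> \<in> ?I \<times> ?I \<times> ?I" if "\<xi> \<in> L" for \<xi>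
  proof -
    have I: "x \<in> {-1..1}" if "\<bar>x\<bar> \<le> 1" for x :: real using that by auto
    have "\<bar>sg \<xi> * cos (pi * snd \<xi>)\<bar> \<le> 1" "\<bar>sg \<xi> * sin (pi * snd \<xi>)\<bar> \<le> 1"
      using abs_sg[OF that] by (simp_all add: abs_mult)
    moreover have "\<bar>fst \<xi> / n \<xi>\<bar> \<le> 1" "\<bar>snd \<xi> / n \<xi>\<bar> \<le> 1"
      by (auto simp: n_def abs_divide divide_le_eq_1)
    ultimately show ?thesis
      unfolding F_def by (auto intro!: SigmaI I simp del: abs_divide)
  qed
  then have "range (F \<circ> f) \<subseteq> ?I \<times> ?I \<times> ?I"
    using f assms(2) unfolding o_def by (intro image_subsetI F_in) blast
  then have "bounded (range (F \<circ> f))"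
    by (rule bounded_subset[rotated]) (intro bounded_Times bounded_closed_interval)
  then obtain l0 r where r: "strict_mono r" "((F \<circ> f) \<circ> r) \<longlonglongrightarrow> l0"
    using bounded_imp_convergent_subsequence by blast
  obtain p q p' q' B A where l0: "l0 = ((p, q), (p', q'), (B, A))" by (metis prod.exhaust)
  define l where "l = f \<circ> r"
  have l: "l j \<in> L'" "l j \<in> L" for j using f assms(2) by (auto simp: l_def)
  have lim: "(\<lambda>j. F (l j)) \<longlonglongrightarrow> ((p, q), (p', q'), (B, A))"
    using r(2) by (simp add: l0 l_def o_def)
  note lims = tendsto_fst[OF lim] tendsto_snd[OF lim]
  have lims: "(\<lambda>j. cos (pi * fst (l j))) \<longlonglongrightarrow> p" "(\<lambda>j. sin (pi * fst (l j))) \<longlonglongrightarrow> q"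
    "(\<lambda>j. sg (l j) * cos (pi * snd (l j))) \<longlonglongrightarrow> p'" "(\<lambda>j. sg (l j) * sin (pi * snd (l j))) \<longlonglongrightarrow> q'"
    "(\<lambda>j. fst (l j) / n (l j)) \<longlonglongrightarrow> B" "(\<lambda>j. snd (l j) / n (l j)) \<longlonglongrightarrow> A"
    using tendsto_fst[OF lims(1)] tendsto_snd[OF lims(1)] tendsto_fst[OF tendsto_fst[OF lims(2)]]
      tendsto_snd[OF tendsto_fst[OF lims(2)]] tendsto_fst[OF tendsto_snd[OF lims(2)]]
      tendsto_snd[OF tendsto_snd[OF lims(2)]]
    by (simp_all add: F_def)
  have inj: "inj l" unfolding l_def using f(1) r(1) by (simp add: inj_compose strict_mono_imp_inj_on)
  have n_top: "filterlim (\<lambda>j. n (l j)) at_top sequentially"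
    unfolding filterlim_at_top
  proof
    fix M
    \<comment> \<open>By injectivity of \<open>l\<close>, only finitely many indices stay in a given
      strip, hence in a given ball of \<open>n\<close>.\<close>
    have "l ` {j. \<not> M \<le> n (l j)} \<subseteq> {\<xi> \<in> L. \<bar>fst \<xi>\<bar> \<le> M}"
      using l by (auto simp: n_def)
    then have "finite {j. \<not> M \<le> n (l j)}"
      using finite_bounded_part inj by (meson finite_imageD finite_subset inj_on_subset subset_UNIV)
    then show "\<forall>\<^sub>F j in sequentially. M \<le> n (l j)"
      by (simp flip: cofinite_eq_sequentially add: eventually_cofinite)
  qed
  have n_pos: "\<forall>\<^sub>F j in sequentially. n (l j) > 0"
    using n_top by (auto simp: filterlim_at_top_dense)
  have pq: "p\<^sup>2 + q\<^sup>2 = 1"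
  proof (rule LIMSEQ_unique)
    show "(\<lambda>j. (cos (pi * fst (l j)))\<^sup>2 + (sin (pi * fst (l j)))\<^sup>2) \<longlonglongrightarrow> p\<^sup>2 + q\<^sup>2"
      by (intro tendsto_intros lims)
  qed simp
  have pq': "p'\<^sup>2 + q'\<^sup>2 = 1"
  proof (rule LIMSEQ_unique)
    show "(\<lambda>j. (sg (l j) * cos (pi * snd (l j)))\<^sup>2 + (sg (l j) * sin (pi * snd (l j)))\<^sup>2) \<longlonglongrightarrow> p'\<^sup>2 + q'\<^sup>2"
      by (intro tendsto_intros lims)
    show "(\<lambda>j. (sg (l j) * cos (pi * snd (l j)))\<^sup>2 + (sg (l j) * sin (pi * snd (l j)))\<^sup>2) \<longlonglongrightarrow> 1"
      using sg[OF l(2)] by (simp add: power_mult_distrib flip: distrib_left)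
  qed
  have AB: "\<bar>B\<bar> + \<bar>A\<bar> = 1"
  proof (rule LIMSEQ_unique)
    show "(\<lambda>j. \<bar>fst (l j) / n (l j)\<bar> + \<bar>snd (l j) / n (l j)\<bar>) \<longlonglongrightarrow> \<bar>B\<bar> + \<bar>A\<bar>"
      by (intro tendsto_intros lims)
    have "\<forall>\<^sub>F j in sequentially. \<bar>fst (l j) / n (l j)\<bar> + \<bar>snd (l j) / n (l j)\<bar> = 1"
      using n_pos by eventually_elim (auto simp: n_def abs_divide simp flip: add_divide_distrib)
    then show "(\<lambda>j. \<bar>fst (l j) / n (l j)\<bar> + \<bar>snd (l j) / n (l j)\<bar>) \<longlonglongrightarrow> 1"
      by (rule tendsto_eventually)
  qed
  have main: "A * (q * cos (pi * fst \<mu>) - p * sin (pi * fst \<mu>))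
        + B * (sg \<mu> * (q' * cos (pi * snd \<mu>) - p' * sin (pi * snd \<mu>))) = 0" if \<mu>: "\<mu> \<in> L" for \<mu>
  proof (rule LIMSEQ_unique)
    \<comment> \<open>This is \<open>rel\<close> for \<open>l j\<close> and \<open>\<mu>\<close>,
      divided by \<open>n (l j)\<close>, with the sines of differences expanded.\<close>
    let ?h = "\<lambda>j. (snd (l j) / n (l j) - snd \<mu> / n (l j)) *
          (sin (pi * fst (l j)) * cos (pi * fst \<mu>) - cos (pi * fst (l j)) * sin (pi * fst \<mu>))
        + (fst (l j) / n (l j) - fst \<mu> / n (l j)) * (sg \<mu> *
          (sg (l j) * sin (pi * snd (l j)) * cos (pi * snd \<mu>) - sg (l j) * cos (pi * snd (l j)) * sin (pi * snd \<mu>)))"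
    have z: "(\<lambda>j. K / n (l j)) \<longlonglongrightarrow> 0" for K
      by (rule real_tendsto_divide_at_top[OF tendsto_const n_top])
    have "?h \<longlonglongrightarrow> (A - 0) * (q * cos (pi * fst \<mu>) - p * sin (pi * fst \<mu>))
        + (B - 0) * (sg \<mu> * (q' * cos (pi * snd \<mu>) - p' * sin (pi * snd \<mu>)))"
      by (intro tendsto_intros lims z)
    then show "?h \<longlonglongrightarrow> A * (q * cos (pi * fst \<mu>) - p * sin (pi * fst \<mu>))
        + B * (sg \<mu> * (q' * cos (pi * snd \<mu>) - p' * sin (pi * snd \<mu>)))" by simp
    have "?h j = ((snd (l j) - snd \<mu>) * sin (pi * (fst (l j) - fst \<mu>))
        + sg (l j) * sg \<mu> * ((fst (l j) - fst \<mu>) * sin (pi * (snd (l j) - snd \<mu>)))) / n (l j)" for j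
      by (simp add: right_diff_distrib[of pi] sin_diff add_divide_distrib diff_divide_distrib[symmetric])
         (simp add: algebra_simps)
    then have "?h j = 0" for j using rel[OF l(2) \<mu>] by simp
    then show "?h \<longlonglongrightarrow> 0" by simp
  qed
  have "A \<noteq> 0"
  proof
    assume "A = 0"
    then have "B \<noteq> 0" using AB by auto
    \<comment> \<open>All second vectors would be parallel to \<open>(p', q')\<close>, so second
      coordinates would differ by integers.\<close>
    have *: "q' * cos (pi * snd \<mu>) = p' * sin (pi * snd \<mu>)" if "\<mu> \<in> L" for \<mu>
      using main[OF that] \<open>A = 0\<close> \<open>B \<noteq> 0\<close> abs_sg[OF that] by auto
    have lm: "l 0 \<in> L" "l 1 \<in> L" "l 0 \<noteq> l 1" using l inj by (auto dest: injD)
    let ?s = "sin (pi * (snd (l 0) - snd (l 1)))"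
    have "?s = sin (pi * snd (l 0)) * cos (pi * snd (l 1)) - cos (pi * snd (l 0)) * sin (pi * snd (l 1))"
      by (simp add: right_diff_distrib sin_diff)
    then have "q' * ?s = 0" "p' * ?s = 0"
      using *[OF lm(1)] *[OF lm(2)] by algebra+
    then have "?s = 0" using pq' by auto
    then show False using nonint_snd[OF lm] sin_times_pi_eq_0[of "snd (l 0) - snd (l 1)"]
      by (simp add: mult.commute)
  qed
  then show thesis using that[OF _ pq main l(1) lims(1,2)] by blast
qed

end

text \<open>A nonzero binary quadratic form vanishes on at most two lines. The product
  \<open>?D\<close> is the homogeneous Vandermonde determinant of the linear system for the
  coefficients.\<close>

lemma binary_quadratic_form_eq_0:
  fixes a b d :: real
  assumes q: "a * v1\<^sup>2 + b * (v1 * w1) + d * w1\<^sup>2 = 0" "a * v2\<^sup>2 + b * (v2 * w2) + d * w2\<^sup>2 = 0"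
      "a * v3\<^sup>2 + b * (v3 * w3) + d * w3\<^sup>2 = 0"
    and D: "v1 * w2 - w1 * v2 \<noteq> 0" "v1 * w3 - w1 * v3 \<noteq> 0" "v2 * w3 - w2 * v3 \<noteq> 0"
  shows "a = 0" "b = 0" "d = 0"
proof -
  let ?D = "(v1 * w2 - w1 * v2) * (v1 * w3 - w1 * v3) * (v2 * w3 - w2 * v3)"
  have "a * ?D = 0" "b * ?D = 0" "d * ?D = 0" using q by algebra+
  then show "a = 0" "b = 0" "d = 0" using D by auto
qed

section \<open>Uniqueness of the limit direction and the sampling contradiction\<close>

context twisted_set
begin

lemma sin_diff_snd:
  fixes \<xi> \<mu> :: "real \<times> real"
  shows "sin (pi * (snd \<xi> - snd \<mu>)) = sin (pi * snd \<xi>) * cos (pi * snd \<mu>) - cos (pi * snd \<xi>) * sin (pi * snd \<mu>)"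
  by (simp add: right_diff_distrib sin_diff)

lemma sin_diff_fst:
  fixes \<xi> \<mu> :: "real \<times> real"
  shows "sin (pi * (fst \<xi> - fst \<mu>)) = sin (pi * fst \<xi>) * cos (pi * fst \<mu>) - cos (pi * fst \<xi>) * sin (pi * fst \<mu>)"
  by (simp add: right_diff_distrib sin_diff)

text \<open>The form comparing the squared length of the image with that of the vector vanishes at
  three pairwise non-parallel unit vectors, so the map is orthogonal. Inserting its determinant
  \<open>D\<close> into \<open>rel\<close> gives \<open>a = - D * b\<close>; as
  \<open>a \<noteq> b\<close>, only \<open>D = 1\<close> is left, and every pair of points then has
  sign product -1.\<close>

lemma not_linear_image:
  assumes "infinite L"
    and S: "\<And>\<mu>. \<mu> \<in> L \<Longrightarrow>
        cos (pi * fst \<mu>) = a11 * (sg \<mu> * cos (pi * snd \<mu>)) + a12 * (sg \<mu> * sin (pi * snd \<mu>)) \<and>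
        sin (pi * fst \<mu>) = a21 * (sg \<mu> * cos (pi * snd \<mu>)) + a22 * (sg \<mu> * sin (pi * snd \<mu>))"
  shows False
proof -
  obtain T where T: "T \<subseteq> L" "finite T" "card T = 3"
    using infinite_arbitrarily_large[OF assms(1)] by blast
  obtain x y z where xyz: "x \<in> L" "y \<in> L" "z \<in> L" "x \<noteq> y" "x \<noteq> z" "y \<noteq> z"
    using T by (auto simp: card_3_iff)
  define v w where "v \<mu> = sg \<mu> * cos (pi * snd \<mu>)" and "w \<mu> = sg \<mu> * sin (pi * snd \<mu>)" for \<mu>
  have wedge: "v \<xi> * w \<mu> - w \<xi> * v \<mu> = - (sg \<xi> * sg \<mu> * sin (pi * (snd \<xi> - snd \<mu>)))" for \<xi> \<mu>
    unfolding v_def w_def sin_diff_snd by algebra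
  have sin_snd: "sin (pi * (snd \<xi> - snd \<mu>)) \<noteq> 0" if "\<xi> \<in> L" "\<mu> \<in> L" "\<xi> \<noteq> \<mu>" for \<xi> \<mu>
    using nonint_snd[OF that] sin_times_pi_eq_0[of "snd \<xi> - snd \<mu>"] by (simp add: mult.commute)
  have sg0: "sg \<xi> \<noteq> 0" if "\<xi> \<in> L" for \<xi> using sg[OF that] by auto
  have wedge0: "v \<xi> * w \<mu> - w \<xi> * v \<mu> \<noteq> 0" if "\<xi> \<in> L" "\<mu> \<in> L" "\<xi> \<noteq> \<mu>" for \<xi> \<mu>
    unfolding wedge using sin_snd[OF that] sg0 that by simp
  have Q: "(a11\<^sup>2 + a21\<^sup>2 - 1) * (v \<mu>)\<^sup>2 + (2 * (a11 * a12 + a21 * a22)) * (v \<mu> * w \<mu>)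
      + (a12\<^sup>2 + a22\<^sup>2 - 1) * (w \<mu>)\<^sup>2 = 0" if "\<mu> \<in> L" for \<mu>
  proof -
    have "(a11 * v \<mu> + a12 * w \<mu>)\<^sup>2 + (a21 * v \<mu> + a22 * w \<mu>)\<^sup>2 = 1"
      using S[OF that] by (simp add: v_def w_def) (metis sin_cos_squared_add2)
    moreover have "(v \<mu>)\<^sup>2 + (w \<mu>)\<^sup>2 = 1"
      using sg[OF that] by (simp add: v_def w_def power_mult_distrib)
    ultimately show ?thesis by algebra
  qed
  note orth = binary_quadratic_form_eq_0[OF Q[OF xyz(1)] Q[OF xyz(2)] Q[OF xyz(3)]
      wedge0[OF xyz(1,2,4)] wedge0[OF xyz(1,3,5)] wedge0[OF xyz(2,3,6)]]
  define D where "D = a11 * a22 - a12 * a21"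
  \<comment> \<open>Lagrange's identity for two orthonormal columns.\<close>
  have D2: "D\<^sup>2 = 1" using orth unfolding D_def by algebra
  have neg: "sg \<xi> * sg \<mu> = -1" if lm: "\<xi> \<in> L" "\<mu> \<in> L" "\<xi> \<noteq> \<mu>" for \<xi> \<mu>
  proof -
    define a b where "a = fst \<xi> - fst \<mu>" and "b = snd \<xi> - snd \<mu>"
    have s2: "(sg \<xi> * sg \<mu>)\<^sup>2 = 1" using sg lm by (simp add: power_mult_distrib)
    have sin_a: "sin (pi * a) = D * (sg \<xi> * sg \<mu> * sin (pi * b))"
      unfolding a_def b_def sin_diff_fst sin_diff_snd conjunct1[OF S[OF lm(1)]] conjunct1[OF S[OF lm(2)]]
        conjunct2[OF S[OF lm(1)]] conjunct2[OF S[OF lm(2)]] D_def by algebra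
    have r: "b * sin (pi * a) + sg \<xi> * sg \<mu> * (a * sin (pi * b)) = 0"
      using rel[OF lm(1,2)] by (simp add: a_def b_def)
    have "(D * b + a) * (sg \<xi> * sg \<mu> * sin (pi * b)) = 0"
      using r unfolding sin_a by algebra
    then have "D * b + a = 0" using sin_snd[OF lm] sg0 lm by (simp add: b_def)
    moreover have "D = 1 \<or> D = -1" using D2 by (simp add: power2_eq_1_iff)
    ultimately have D1: "D = 1" "a = - b"
      using diff_neq[OF lm] by (auto simp: a_def b_def)
    then have "(sg \<xi> * sg \<mu> + 1) * sin (pi * b) = 0"
      using sin_a by (simp add: distrib_right)
    then show ?thesis using sin_snd[OF lm] by (simp add: b_def)
  qed
  \<comment> \<open>The product of the three pair signs is a square, hence 1, whereas three factors
    -1 give -1.\<close>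
  have "(sg x * sg y) * (sg x * sg z) * (sg y * sg z) = (sg x)\<^sup>2 * (sg y)\<^sup>2 * (sg z)\<^sup>2"
    by (simp add: power2_eq_square)
  then show False using neg[OF xyz(1,2,4)] neg[OF xyz(1,3,5)] neg[OF xyz(2,3,6)] sg xyz by simp
qed

text \<open>The expression is the determinant of the first unit vector of \<open>\<mu>\<close> with
  \<open>(p, q)\<close>; its smallness means that the first coordinates are nearly congruent modulo
  1. Infinitely many exceptions would provide a second, non-parallel limit direction, and the two
  resulting equations would make the first vectors a linear image of the second ones.\<close>

lemma fst_near_progression:
  assumes "infinite L"
  obtains p q where "p\<^sup>2 + q\<^sup>2 = 1"
    "\<And>\<epsilon>. \<epsilon> > 0 \<Longrightarrow> finite {\<mu> \<in> L. \<bar>q * cos (pi * fst \<mu>) - p * sin (pi * fst \<mu>)\<bar> \<ge> \<epsilon>}"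
proof -
  obtain A B p q p' q' l where 1: "A \<noteq> 0" "p\<^sup>2 + q\<^sup>2 = 1"
    "\<And>\<mu>. \<mu> \<in> L \<Longrightarrow> A * (q * cos (pi * fst \<mu>) - p * sin (pi * fst \<mu>))
        + B * (sg \<mu> * (q' * cos (pi * snd \<mu>) - p' * sin (pi * snd \<mu>))) = 0"
    "\<And>j::nat. l j \<in> L"
    "(\<lambda>j. cos (pi * fst (l j))) \<longlonglongrightarrow> p" "(\<lambda>j. sin (pi * fst (l j))) \<longlonglongrightarrow> q"
    using assms order_refl by (rule limit_relation) blast
  have "finite {\<mu> \<in> L. \<bar>q * cos (pi * fst \<mu>) - p * sin (pi * fst \<mu>)\<bar> \<ge> \<epsilon>}" if "\<epsilon> > 0" for \<epsilon>
  proof (rule ccontr)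
    let ?L = "{\<mu> \<in> L. \<bar>q * cos (pi * fst \<mu>) - p * sin (pi * fst \<mu>)\<bar> \<ge> \<epsilon>}"
    assume "infinite ?L"
    moreover have "?L \<subseteq> L" by blast
    ultimately obtain A2 B2 p2 q2 p2' q2' l2 where 2: "A2 \<noteq> 0" "p2\<^sup>2 + q2\<^sup>2 = 1"
      "\<And>\<mu>. \<mu> \<in> L \<Longrightarrow> A2 * (q2 * cos (pi * fst \<mu>) - p2 * sin (pi * fst \<mu>))
          + B2 * (sg \<mu> * (q2' * cos (pi * snd \<mu>) - p2' * sin (pi * snd \<mu>))) = 0"
      "\<And>j::nat. l2 j \<in> ?L"
      "(\<lambda>j. cos (pi * fst (l2 j))) \<longlonglongrightarrow> p2" "(\<lambda>j. sin (pi * fst (l2 j))) \<longlonglongrightarrow> q2"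
      by (rule limit_relation) blast
    have "\<epsilon> \<le> \<bar>q * p2 - p * q2\<bar>"
    proof (rule LIMSEQ_le_const)
      show "(\<lambda>j. \<bar>q * cos (pi * fst (l2 j)) - p * sin (pi * fst (l2 j))\<bar>) \<longlonglongrightarrow> \<bar>q * p2 - p * q2\<bar>"
        by (intro tendsto_intros 2)
      show "\<exists>N. \<forall>j\<ge>N. \<epsilon> \<le> \<bar>q * cos (pi * fst (l2 j)) - p * sin (pi * fst (l2 j))\<bar>"
        using 2(4) by blast
    qed
    then have E: "p * q2 - q * p2 \<noteq> 0" (is "?E \<noteq> 0") using \<open>\<epsilon> > 0\<close> by auto
    let ?k = "- B / A" and ?k2 = "- B2 / A2"
    show False
    proof (rule not_linear_image[OF assms])
      fix \<mu> assume \<mu>: "\<mu> \<in> L"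
      define X Y V W where "X = cos (pi * fst \<mu>)" and "Y = sin (pi * fst \<mu>)"
        and "V = sg \<mu> * cos (pi * snd \<mu>)" and "W = sg \<mu> * sin (pi * snd \<mu>)"
      have "A * (q * X - p * Y) = - B * (q' * V - p' * W)"
        "A2 * (q2 * X - p2 * Y) = - B2 * (q2' * V - p2' * W)"
        using 1(3)[OF \<mu>] 2(3)[OF \<mu>] unfolding X_def Y_def V_def W_def by algebra+
      then have r: "q * X - p * Y = ?k * (q' * V - p' * W)" "q2 * X - p2 * Y = ?k2 * (q2' * V - p2' * W)"
        using 1(1) 2(1) by (simp_all add: field_simps)
      \<comment> \<open>Cramer's rule for the two equations \<open>r\<close>; \<open>?E\<close> is
        the determinant of the two limit directions.\<close>
      have "X * ?E = p * (?k2 * (q2' * V - p2' * W)) - p2 * (?k * (q' * V - p' * W))"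
        unfolding r[symmetric] by algebra
      moreover have "Y * ?E = q * (?k2 * (q2' * V - p2' * W)) - q2 * (?k * (q' * V - p' * W))"
        unfolding r[symmetric] by algebra
      ultimately have
        "X = (p * ?k2 * q2' - p2 * ?k * q') / ?E * V + (p2 * ?k * p' - p * ?k2 * p2') / ?E * W"
        "Y = (q * ?k2 * q2' - q2 * ?k * q') / ?E * V + (q2 * ?k * p' - q * ?k2 * p2') / ?E * W"
        using E by (simp_all add: nonzero_eq_divide_eq add_divide_distrib[symmetric] algebra_simps
            del: minus_divide_left divide_minus_left)
      then show "cos (pi * fst \<mu>) = (p * ?k2 * q2' - p2 * ?k * q') / ?E * (sg \<mu> * cos (pi * snd \<mu>))
            + (p2 * ?k * p' - p * ?k2 * p2') / ?E * (sg \<mu> * sin (pi * snd \<mu>)) \<and>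
          sin (pi * fst \<mu>) = (q * ?k2 * q2' - q2 * ?k * q') / ?E * (sg \<mu> * cos (pi * snd \<mu>))
            + (q2 * ?k * p' - q * ?k2 * p2') / ?E * (sg \<mu> * sin (pi * snd \<mu>))"
        unfolding X_def Y_def V_def W_def by blast
    qed
  qed
  with 1(2) show thesis by (rule that)
qed

text \<open>In the orthonormal frame given by \<open>(p, q)\<close>, \<open>C\<close> is the
  component along the limit direction and \<open>D\<close> the one across it. The sine of the angle
  difference is a determinant in these components.\<close>

lemma abs_sin_diff_fst_le:
  fixes \<xi> \<mu> :: "real \<times> real"
  assumes pq: "p\<^sup>2 + q\<^sup>2 = 1"
    and "\<bar>q * cos (pi * fst \<xi>) - p * sin (pi * fst \<xi>)\<bar> \<le> \<epsilon>"
        "\<bar>q * cos (pi * fst \<mu>) - p * sin (pi * fst \<mu>)\<bar> \<le> \<epsilon>"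
  shows "\<bar>sin (pi * (fst \<xi> - fst \<mu>))\<bar> \<le> 2 * \<epsilon>"
proof -
  define C D where "C \<nu> = p * cos (pi * fst \<nu>) + q * sin (pi * fst \<nu>)"
    and "D \<nu> = q * cos (pi * fst \<nu>) - p * sin (pi * fst \<nu>)" for \<nu> :: "real \<times> real"
  have "(C \<nu>)\<^sup>2 + (D \<nu>)\<^sup>2 = 1" for \<nu>
    using pq sin_cos_squared_add[of "pi * fst \<nu>"] unfolding C_def D_def by algebra
  then have "(C \<nu>)\<^sup>2 \<le> 1" for \<nu> by (metis le_add_same_cancel1 zero_le_power2)
  then have C: "\<bar>C \<nu>\<bar> \<le> 1" for \<nu> by (simp add: abs_square_le_1)
  have "sin (pi * (fst \<xi> - fst \<mu>)) = C \<xi> * D \<mu> - D \<xi> * C \<mu>"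
    using pq unfolding C_def D_def sin_diff_fst by algebra
  also have "\<bar>\<dots>\<bar> \<le> \<bar>C \<xi>\<bar> * \<bar>D \<mu>\<bar> + \<bar>D \<xi>\<bar> * \<bar>C \<mu>\<bar>"
    by (metis abs_mult abs_triangle_ineq4)
  also have "\<dots> \<le> 1 * \<epsilon> + \<epsilon> * 1"
    using assms C by (intro add_mono mult_mono) (auto simp: D_def)
  finally show ?thesis by simp
qed

text \<open>At a far point of \<open>L\<close> the sum splits into the point itself, which
  contributes 1, a finite exceptional set, and points at nearly integer distance. The last two
  contribute at most 1/4 each, so the total cannot exceed 3/2.\<close>

lemma sampling_deficient:
  assumes samp: "\<And>x \<delta>. \<delta> > 0 \<Longrightarrow> \<exists>S. finite S \<and> S \<subseteq> L \<and> 2 - \<delta> < (\<Sum>\<eta>\<in>S. (nsinc (x - fst \<eta>))\<^sup>2)"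
  shows False
proof -
  have inf: "infinite L"
  proof
    assume fin: "finite L"
    obtain M where M: "\<And>x. \<bar>x\<bar> \<ge> M \<Longrightarrow> (\<Sum>\<mu>\<in>L. (nsinc (x - fst \<mu>))\<^sup>2) \<le> 1"
      using sum_nsinc_far[OF fin zero_less_one] by blast
    obtain S where S: "S \<subseteq> L" "2 - 1 < (\<Sum>\<eta>\<in>S. (nsinc (M - fst \<eta>))\<^sup>2)"
      using samp[OF zero_less_one] by blast
    have "(\<Sum>\<eta>\<in>S. (nsinc (M - fst \<eta>))\<^sup>2) \<le> (\<Sum>\<eta>\<in>L. (nsinc (M - fst \<eta>))\<^sup>2)"
      using S fin by (intro sum_mono2) auto
    with M[OF abs_ge_self[of M]] S show False by linarith
  qed
  obtain g where g: "0 < g" "g \<le> 1"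
    "\<And>\<xi> \<mu>. \<xi> \<in> L \<Longrightarrow> \<mu> \<in> L \<Longrightarrow> \<xi> \<noteq> \<mu> \<Longrightarrow> g \<le> \<bar>fst \<xi> - fst \<mu>\<bar>"
    by (rule gap) blast
  obtain C where C: "C > 0"
    "\<And>F \<epsilon> g. finite F \<Longrightarrow> 2 * \<epsilon> < g \<Longrightarrow> g \<le> 1 \<Longrightarrow> \<forall>a\<in>F. \<bar>sin (pi * a)\<bar> \<le> \<epsilon> \<and> g \<le> \<bar>a\<bar> \<Longrightarrow>
       \<forall>a\<in>F. \<forall>b\<in>F. a \<noteq> b \<longrightarrow> g \<le> \<bar>a - b\<bar> \<Longrightarrow> (\<Sum>a\<in>F. (nsinc a)\<^sup>2) \<le> C * \<epsilon>\<^sup>2"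
    by (rule sum_nsinc_near_integers) blast
  obtain p q where pq: "p\<^sup>2 + q\<^sup>2 = 1"
    "\<And>\<epsilon>. \<epsilon> > 0 \<Longrightarrow> finite {\<mu> \<in> L. \<bar>q * cos (pi * fst \<mu>) - p * sin (pi * fst \<mu>)\<bar> \<ge> \<epsilon>}"
    using inf by (rule fst_near_progression) blast
  \<comment> \<open>The first bound yields \<open>2 * \<epsilon> < g\<close>; the second yields both
    \<open>C * \<epsilon> \<le> 1/4\<close> and \<open>\<epsilon> \<le> 1\<close>.\<close>
  define \<epsilon> where "\<epsilon> = min (g / 3) (1 / (4 * (1 + C)))"
  have \<epsilon>: "0 < \<epsilon>" "2 * \<epsilon> < g" "\<epsilon> \<le> 1 / (4 * (1 + C))"
    using g(1) C(1) by (auto simp: \<epsilon>_def min_def)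
  have "\<epsilon> * (4 * (1 + C)) \<le> 1" using \<epsilon>(3) C(1) by (simp add: field_simps)
  moreover have "0 < \<epsilon> * C" using \<epsilon>(1) C(1) by simp
  ultimately have "\<epsilon> * C \<le> 1/4" "\<epsilon> \<le> 1" using \<epsilon>(1) unfolding distrib_left by linarith+
  then have C\<epsilon>: "C * \<epsilon>\<^sup>2 \<le> 1/4"
    using \<epsilon>(1) C(1) mult_mono[of "\<epsilon> * C" "1/4" \<epsilon> 1] by (simp add: power2_eq_square ac_simps)
  \<comment> \<open>The threshold is \<open>\<epsilon> / 2\<close> because passing to differences
    doubles the deviation.\<close>
  define E where "E = {\<mu> \<in> L. \<bar>q * cos (pi * fst \<mu>) - p * sin (pi * fst \<mu>)\<bar> \<ge> \<epsilon> / 2}"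
  have finE: "finite E" unfolding E_def using \<epsilon> by (intro pq(2)) auto
  obtain M where M: "\<And>x. \<bar>x\<bar> \<ge> M \<Longrightarrow> (\<Sum>\<mu>\<in>E. (nsinc (x - fst \<mu>))\<^sup>2) \<le> 1/4"
    using sum_nsinc_far[OF finE, of "1/4"] by auto
  have "infinite (L - {\<xi> \<in> L. \<bar>fst \<xi>\<bar> \<le> M} - E)"
    using inf finE finite_bounded_part by (simp add: Diff_infinite_finite)
  then obtain \<xi> where "\<xi> \<in> L - {\<xi> \<in> L. \<bar>fst \<xi>\<bar> \<le> M} - E" using infinite_imp_nonempty by blast
  then have \<xi>: "\<xi> \<in> L" "\<bar>fst \<xi>\<bar> \<ge> M" "\<xi> \<notin> E" by auto
  obtain S where S: "finite S" "S \<subseteq> L" "2 - 1/2 < (\<Sum>\<eta>\<in>S. (nsinc (fst \<xi> - fst \<eta>))\<^sup>2)"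
    using samp[of "1/2"] by auto
  define T where "T = S - E - {\<xi>}"
  have T: "finite T" "\<And>\<eta>. \<eta> \<in> T \<Longrightarrow> \<eta> \<in> L \<and> \<eta> \<notin> E \<and> \<xi> \<noteq> \<eta>" using S by (auto simp: T_def)
  have "(\<Sum>\<eta>\<in>S. (nsinc (fst \<xi> - fst \<eta>))\<^sup>2) \<le> (\<Sum>\<eta>\<in>insert \<xi> (E \<union> T). (nsinc (fst \<xi> - fst \<eta>))\<^sup>2)"
    using finE T(1) by (intro sum_mono2) (auto simp: T_def)
  also have "\<dots> = 1 + ((\<Sum>\<eta>\<in>E. (nsinc (fst \<xi> - fst \<eta>))\<^sup>2) + (\<Sum>\<eta>\<in>T. (nsinc (fst \<xi> - fst \<eta>))\<^sup>2))"
  proof -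
    have "\<xi> \<notin> E \<union> T" "E \<inter> T = {}" using T(2) \<xi>(3) by blast+
    then show ?thesis using finE T(1) by (simp add: sum.union_disjoint)
  qed
  also have "(\<Sum>\<eta>\<in>E. (nsinc (fst \<xi> - fst \<eta>))\<^sup>2) \<le> 1/4" by (rule M[OF \<xi>(2)])
  also have "(\<Sum>\<eta>\<in>T. (nsinc (fst \<xi> - fst \<eta>))\<^sup>2) \<le> 1/4"
  proof -
    let ?d = "\<lambda>\<eta>. fst \<xi> - fst \<eta>"
    have "inj_on ?d T"
    proof (rule inj_onI, rule ccontr)
      fix \<eta> \<nu> assume "\<eta> \<in> T" "\<nu> \<in> T" "?d \<eta> = ?d \<nu>" "\<eta> \<noteq> \<nu>"
      with T(2) g(1) g(3)[of \<eta> \<nu>] show False by auto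
    qed
    then have "(\<Sum>\<eta>\<in>T. (nsinc (?d \<eta>))\<^sup>2) = (\<Sum>a\<in>?d ` T. (nsinc a)\<^sup>2)"
      by (simp add: sum.reindex)
    also have "\<dots> \<le> C * \<epsilon>\<^sup>2"
    proof (rule C(2)[OF _ \<epsilon>(2) g(2)])
      have "\<bar>sin (pi * ?d \<eta>)\<bar> \<le> 2 * (\<epsilon> / 2)" if "\<eta> \<in> T" for \<eta>
        using T(2)[OF that] \<xi> by (intro abs_sin_diff_fst_le[OF pq(1)]) (auto simp: E_def)
      then show "\<forall>a\<in>?d ` T. \<bar>sin (pi * a)\<bar> \<le> \<epsilon> \<and> g \<le> \<bar>a\<bar>"
        using T(2) g(3)[OF \<xi>(1)] by auto
      show "\<forall>a\<in>?d ` T. \<forall>b\<in>?d ` T. a \<noteq> b \<longrightarrow> g \<le> \<bar>a - b\<bar>"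
      proof safe
        fix \<eta> \<nu> assume *: "\<eta> \<in> T" "\<nu> \<in> T" "?d \<eta> \<noteq> ?d \<nu>"
        then have "g \<le> \<bar>fst \<nu> - fst \<eta>\<bar>" using T(2) by (intro g(3)) auto
        then show "g \<le> \<bar>?d \<eta> - ?d \<nu>\<bar>" by simp
      qed
    qed (use T in simp)
    finally show ?thesis using C\<epsilon> by simp
  qed
  finally show False using S(3) by simp
qed

end

section \<open>Sampling sums of a spectrum\<close>

lemma set_integrable_bounded_Icc:
  fixes h :: "real \<Rightarrow> 'b::{banach, second_countable_topology}"
  assumes "h \<in> borel_measurable borel" "\<And>s. norm (h s) \<le> B"
  shows "set_integrable lborel {a..b} h"
  unfolding set_integrable_def
  by (rule integrableI_bounded_set_indicator[where B = B]) (use assms in \<open>auto simp: emeasure_lborel_Icc_eq\<close>)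

lemma integrable_rho_bounded:
  fixes g :: "real \<times> real \<Rightarrow> 'b::{banach, second_countable_topology}"
  assumes "g \<in> borel_measurable borel" "\<And>x. norm (g x) \<le> B"
  shows "integrable (rho t) g"
proof -
  interpret prob_space "rho t" by (rule prob_space_rho)
  have "g \<in> borel_measurable (rho t)" using assms(1) by (simp cong: measurable_cong_sets)
  then show ?thesis using assms(2) by (intro integrable_const_bound[where B = B]) auto
qed

lemma borel_measurable_axes:
  fixes g :: "real \<times> real \<Rightarrow> 'b::topological_space"
  assumes "g \<in> borel_measurable borel"
  shows "(\<lambda>s. g (s, 0)) \<in> borel_measurable borel" "(\<lambda>s. g (0, s)) \<in> borel_measurable borel"
  by (rule measurable_compose[OF _ assms]; simp add: borel_prod[symmetric])+

text \<open>First of three stages: bounded nonnegative integrands come from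
  \<open>nn_integral_rho\<close>, real ones by adding a constant, complex ones through real and
  imaginary parts.\<close>

lemma integral_rho_nonneg:
  fixes g :: "real \<times> real \<Rightarrow> real"
  assumes g: "g \<in> borel_measurable borel" and nn: "\<And>x. 0 \<le> g x" and B: "\<And>x. g x \<le> B"
  shows "(\<integral>x. g x \<partial>rho t)
    = (LINT s:{t..t+1}|lborel. g (s, 0)) / 2 + (LINT s:{t..t+1}|lborel. g (0, s)) / 2"
proof -
  have axis: "(\<integral>\<^sup>+s\<in>{t..t+1}. ennreal (h s) \<partial>lborel) = ennreal (LINT s:{t..t+1}|lborel. h s)
      \<and> 0 \<le> (LINT s:{t..t+1}|lborel. h s)"
    if h: "h \<in> borel_measurable borel" "\<And>s. 0 \<le> h s" "\<And>s. h s \<le> B" for h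
  proof -
    have "set_integrable lborel {t..t+1} h"
      using h by (intro set_integrable_bounded_Icc[where B = B]) auto
    then have "(\<integral>\<^sup>+s. ennreal (indicator {t..t+1} s *\<^sub>R h s) \<partial>lborel)
        = ennreal (LINT s:{t..t+1}|lborel. h s)"
      unfolding set_integrable_def set_lebesgue_integral_def
      by (rule nn_integral_eq_integral) (use h in auto)
    also have "(\<integral>\<^sup>+s. ennreal (indicator {t..t+1} s *\<^sub>R h s) \<partial>lborel)
        = (\<integral>\<^sup>+s\<in>{t..t+1}. ennreal (h s) \<partial>lborel)"
      by (rule nn_integral_cong) (auto simp: indicator_def)
    finally show ?thesis
      using h unfolding set_lebesgue_integral_def by (auto intro!: integral_nonneg)
  qed
  note a1 = axis[of "\<lambda>s. g (s, 0)", OF borel_measurable_axes(1)[OF g] nn B]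
  note a2 = axis[of "\<lambda>s. g (0, s)", OF borel_measurable_axes(2)[OF g] nn B]
  have half: "(1/2::ennreal) * ennreal r = ennreal (r / 2)" if "0 \<le> r" for r
    using that divide_ennreal[of 1 2] ennreal_mult'[of "1/2" r] by simp
  have "(\<integral>x. g x \<partial>rho t) = enn2real (\<integral>\<^sup>+x. ennreal (g x) \<partial>rho t)"
    using g nn by (intro integral_eq_nn_integral) (auto cong: measurable_cong_sets)
  also have "(\<integral>\<^sup>+x. ennreal (g x) \<partial>rho t)
      = ennreal ((LINT s:{t..t+1}|lborel. g (s, 0)) / 2 + (LINT s:{t..t+1}|lborel. g (0, s)) / 2)"
    using a1 a2 by (subst nn_integral_rho) (use g in \<open>auto simp: half ennreal_plus\<close>)
  finally show ?thesis using a1 a2 by (simp flip: ennreal_plus)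
qed

lemma integral_rho_real:
  fixes g :: "real \<times> real \<Rightarrow> real"
  assumes g: "g \<in> borel_measurable borel" and B: "\<And>x. \<bar>g x\<bar> \<le> B"
  shows "(\<integral>x. g x \<partial>rho t)
    = (LINT s:{t..t+1}|lborel. g (s, 0)) / 2 + (LINT s:{t..t+1}|lborel. g (0, s)) / 2"
proof -
  interpret prob_space "rho t" by (rule prob_space_rho)
  have "integrable (rho t) g" using g B by (intro integrable_rho_bounded) auto
  \<comment> \<open>The shift by \<open>B\<close> makes the integrand nonnegative. It cancels later
    because \<open>rho t\<close> and the interval both have total mass 1.\<close>
  then have "(\<integral>x. g x + B \<partial>rho t) = (\<integral>x. g x \<partial>rho t) + B"
    using prob_space by simp
  moreover have "(\<integral>x. g x + B \<partial>rho t)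
      = (LINT s:{t..t+1}|lborel. g (s, 0) + B) / 2 + (LINT s:{t..t+1}|lborel. g (0, s) + B) / 2"
  proof (rule integral_rho_nonneg)
    show "0 \<le> g x + B" "g x + B \<le> 2 * B" for x using B[of x] by auto
  qed (use g in simp)
  moreover have "(LINT s:{t..t+1}|lborel. h s + B) = (LINT s:{t..t+1}|lborel. h s) + B"
    if "h \<in> borel_measurable borel" "\<And>s. \<bar>h s\<bar> \<le> B" for h
    using that by (subst set_integral_add(2))
      (auto intro!: set_integrable_bounded_Icc[where B = B] set_integrable_bounded_Icc[where B = "\<bar>B\<bar>"]
        simp: set_lebesgue_integral_def intro: order_trans[OF _ abs_ge_self])
  ultimately show ?thesis using borel_measurable_axes[OF g] B by (simp add: add_divide_distrib)
qed

lemma integral_rho: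
  fixes g :: "real \<times> real \<Rightarrow> complex"
  assumes g: "g \<in> borel_measurable borel" and B: "\<And>x. cmod (g x) \<le> B"
  shows "(\<integral>x. g x \<partial>rho t)
    = (LINT s:{t..t+1}|lborel. g (s, 0)) / 2 + (LINT s:{t..t+1}|lborel. g (0, s)) / 2"
proof -
  have int: "integrable (rho t) g" using g B by (rule integrable_rho_bounded)
  have set: "set_integrable lborel {t..t+1} (\<lambda>s. g (s, 0))" "set_integrable lborel {t..t+1} (\<lambda>s. g (0, s))"
    using borel_measurable_axes[OF g] B by (auto intro: set_integrable_bounded_Icc)
  have Re: "Re (LINT s:{t..t+1}|lborel. h s) = (LINT s:{t..t+1}|lborel. Re (h s))"
    and Im: "Im (LINT s:{t..t+1}|lborel. h s) = (LINT s:{t..t+1}|lborel. Im (h s))"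
    if "set_integrable lborel {t..t+1} h" for h :: "real \<Rightarrow> complex"
    using that integral_Re[of lborel "\<lambda>s. indicator {t..t+1} s *\<^sub>R h s"]
       integral_Im[of lborel "\<lambda>s. indicator {t..t+1} s *\<^sub>R h s"]
    unfolding set_integrable_def set_lebesgue_integral_def by auto
  have "(\<integral>x. Re (g x) \<partial>rho t)
    = (LINT s:{t..t+1}|lborel. Re (g (s, 0))) / 2 + (LINT s:{t..t+1}|lborel. Re (g (0, s))) / 2"
    using g B order_trans[OF abs_Re_le_cmod] by (intro integral_rho_real) auto
  moreover have "(\<integral>x. Im (g x) \<partial>rho t)
    = (LINT s:{t..t+1}|lborel. Im (g (s, 0))) / 2 + (LINT s:{t..t+1}|lborel. Im (g (0, s))) / 2"
    using g B order_trans[OF abs_Im_le_cmod] by (intro integral_rho_real) auto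
  ultimately show ?thesis
    using set int by (intro complex_eqI) (simp_all add: Re Im flip: integral_Re integral_Im)
qed

lemma integral_exponential_Icc:
  "(LINT s:{t..t+1}|lborel. exp (2 * complex_of_real pi * \<i> * complex_of_real (a * s)))
     = cis (pi * ((2 * t + 1) * a)) * of_real (nsinc a)"
proof (cases "a = 0")
  case True
  then show ?thesis by (simp add: set_lebesgue_integral_def)
next
  case False
  let ?f = "\<lambda>s. exp (2 * complex_of_real pi * \<i> * complex_of_real (a * s))"
  define k where "k = 2 * complex_of_real pi * \<i> * complex_of_real a"
  have f_cis: "?f s = cis (2 * pi * (a * s))" for s
    by (simp add: cis_conv_exp mult_ac)
  have k0: "k \<noteq> 0" using False by (simp add: k_def)
  have "(LINT s:{t..t+1}|lborel. ?f s) = ?f (t + 1) / k - ?f t / k"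
    unfolding set_lebesgue_integral_def
  proof (rule integral_FTC_atLeastAtMost)
    fix s :: real
    have "((\<lambda>z. exp (k * z) / k) has_field_derivative exp (k * of_real s)) (at (of_real s))"
      using k0 by (auto intro!: derivative_eq_intros)
    then have "((\<lambda>s. exp (k * of_real s) / k) has_vector_derivative exp (k * of_real s)) (at s within {t..t+1})"
      by (rule has_vector_derivative_real_field)
    then show "((\<lambda>s. ?f s / k) has_vector_derivative ?f s) (at s within {t..t+1})"
      by (simp add: k_def mult.assoc)
  qed (auto intro!: continuous_intros)
  also have "\<dots> = cis (2 * pi * (a * (t + 1))) / k - cis (2 * pi * (a * t)) / k"
    unfolding f_cis ..
  \<comment> \<open>Both end points are referred to the midpoint \<open>t + 1/2\<close>, whose phase
    factors out; the centred remainder gives the sinc value.\<close>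
  also have "cis (2 * pi * (a * (t + 1))) = cis (pi * ((2 * t + 1) * a)) * cis (pi * a)"
    by (simp add: cis_mult algebra_simps)
  also have "cis (2 * pi * (a * t)) = cis (pi * ((2 * t + 1) * a)) * cis (- (pi * a))"
    by (simp add: cis_mult algebra_simps)
  also have "cis (pi * ((2 * t + 1) * a)) * cis (pi * a) / k - cis (pi * ((2 * t + 1) * a)) * cis (- (pi * a)) / k
      = cis (pi * ((2 * t + 1) * a)) * ((cis (pi * a) - cis (- (pi * a))) / k)"
    by (simp add: algebra_simps diff_divide_distrib)
  also have "cis (pi * a) - cis (- (pi * a)) = 2 * \<i> * of_real (sin (pi * a))"
    by (simp add: complex_eq_iff)
  also have "2 * \<i> * of_real (sin (pi * a)) / k = of_real (nsinc a)"
    using False by (simp add: nsinc_def k_def)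
  finally show ?thesis .
qed

section \<open>Orthogonal exponentials and their approximation error\<close>

lemma borel_measurable_cnj [measurable (raw)]:
  assumes "f \<in> borel_measurable M"
  shows "(\<lambda>x. cnj (f x)) \<in> borel_measurable M"
  by (rule measurable_compose[OF assms]) (intro borel_measurable_continuous_onI continuous_intros)

lemma norm_expo [simp]: "cmod (expo \<xi> x) = 1"
  by (simp add: expo_def)

lemma borel_measurable_expo [measurable]: "expo \<xi> \<in> borel_measurable borel"
  unfolding expo_def by (intro borel_measurable_continuous_onI continuous_intros)

lemma expo_mult_cnj: "expo \<xi> x * cnj (expo \<eta> x) = expo (\<xi> - \<eta>) x"
  by (simp add: expo_def exp_cnj inner_diff_left algebra_simps flip: exp_add)

lemma L2_inner_expo_rho:
  "L2_inner (rho t) (expo \<xi>) (expo \<eta>) =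
     (cis (pi * ((2 * t + 1) * (fst \<xi> - fst \<eta>))) * of_real (nsinc (fst \<xi> - fst \<eta>))
    + cis (pi * ((2 * t + 1) * (snd \<xi> - snd \<eta>))) * of_real (nsinc (snd \<xi> - snd \<eta>))) / 2"
proof -
  have e: "expo (\<xi> - \<eta>) (s, 0) = exp (2 * complex_of_real pi * \<i> * complex_of_real ((fst \<xi> - fst \<eta>) * s))"
      "expo (\<xi> - \<eta>) (0, s) = exp (2 * complex_of_real pi * \<i> * complex_of_real ((snd \<xi> - snd \<eta>) * s))" for s
    by (simp_all add: expo_def inner_prod_def)
  have "L2_inner (rho t) (expo \<xi>) (expo \<eta>) = (\<integral>x. expo (\<xi> - \<eta>) x \<partial>rho t)"
    unfolding L2_inner_def expo_mult_cnj ..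
  also have "\<dots> = (LINT s:{t..t+1}|lborel. expo (\<xi> - \<eta>) (s, 0)) / 2
      + (LINT s:{t..t+1}|lborel. expo (\<xi> - \<eta>) (0, s)) / 2"
    by (rule integral_rho[where B = 1]) auto
  finally show ?thesis unfolding e integral_exponential_Icc by (simp add: add_divide_distrib)
qed

text \<open>Bessel's inequality in the form of a best-approximation bound, valid for arbitrary
  coefficients \<open>c\<close>. In the induction one term is moved into the function. Completing
  the square bounds the loss by the squared Fourier coefficient \<open>z\<close>, and orthogonality
  leaves the other coefficients unchanged.\<close>

lemma (in prob_space) L2_distance_lower_bound:
  fixes e :: "'i \<Rightarrow> 'a \<Rightarrow> complex"
  assumes "finite S"
    and e: "\<And>i. e i \<in> borel_measurable M" "\<And>i x. cmod (e i x) = 1"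
    and orth: "\<And>i j. i \<in> S \<Longrightarrow> j \<in> S \<Longrightarrow> i \<noteq> j \<Longrightarrow> (\<integral>x. e i x * cnj (e j x) \<partial>M) = 0"
    and f: "f \<in> borel_measurable M" "\<And>x. cmod (f x) \<le> B"
  shows "(\<integral>x. (cmod (f x))\<^sup>2 \<partial>M) - (\<Sum>i\<in>S. (cmod (\<integral>x. f x * cnj (e i x) \<partial>M))\<^sup>2)
    \<le> (\<integral>x. (cmod (f x - (\<Sum>i\<in>S. c i * e i x)))\<^sup>2 \<partial>M)"
  using assms(1) orth f
proof (induction S arbitrary: f B rule: finite_induct)
  case empty
  then show ?case by simp
next
  case (insert i S)
  note [measurable] = e(1) insert.prems(2)
  define z where "z = (\<integral>x. f x * cnj (e i x) \<partial>M)"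
  define f' where "f' x = f x - c i * e i x" for x
  have [measurable]: "f' \<in> borel_measurable M" unfolding f'_def by measurable
  have B': "cmod (f' x) \<le> B + cmod (c i)" for x
    unfolding f'_def using insert.prems(3)[of x] e(2)[of i x]
    by (intro order_trans[OF norm_triangle_ineq4]) (simp add: norm_mult)
  have int: "integrable M (\<lambda>x. h x * cnj (e j x))" if [measurable]: "h \<in> borel_measurable M"
    and "\<And>x. cmod (h x) \<le> B" for h B j
    using that by (intro integrable_const_bound[where B = B]) (auto simp: norm_mult e(2))
  have int2: "integrable M (\<lambda>x. (cmod (f x))\<^sup>2)"
    using insert.prems(3) by (intro integrable_const_bound[where B = "B\<^sup>2"]) (auto intro!: AE_I2 power_mono)
  have coeff: "(\<integral>x. f' x * cnj (e j x) \<partial>M) = (\<integral>x. f x * cnj (e j x) \<partial>M)" if j: "j \<in> S" for j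
  proof -
    have "(\<integral>x. f' x * cnj (e j x) \<partial>M) = (\<integral>x. f x * cnj (e j x) - c i * (e i x * cnj (e j x)) \<partial>M)"
      by (simp add: f'_def algebra_simps)
    also have "\<dots> = (\<integral>x. f x * cnj (e j x) \<partial>M) - c i * (\<integral>x. e i x * cnj (e j x) \<partial>M)"
      using int[OF insert.prems(2,3)] int[of "e i" 1, OF e(1)] e(2) by simp
    also have "(\<integral>x. e i x * cnj (e j x) \<partial>M) = 0"
      using insert.hyps(2) j by (intro insert.prems(1)) auto
    finally show ?thesis by simp
  qed
  define R where "R x = Re (cnj (c i) * (f x * cnj (e i x)))" for x
  have pointwise: "(cmod (f' x))\<^sup>2 = (cmod (f x))\<^sup>2 - 2 * R x + (cmod (c i))\<^sup>2" for x
  proof -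
    have "(cmod (f' x))\<^sup>2 = (cmod (f x))\<^sup>2 - 2 * R x + (cmod (c i * e i x))\<^sup>2"
      unfolding f'_def R_def cmod_power2 by (simp add: power2_eq_square algebra_simps)
    then show ?thesis by (simp add: norm_mult e(2))
  qed
  have R_int: "integrable M R" and R_eq: "(\<integral>x. R x \<partial>M) = Re (cnj (c i) * z)"
  proof -
    have "integrable M (\<lambda>x. cnj (c i) * (f x * cnj (e i x)))"
      using int[OF insert.prems(2,3), of i] by (rule integrable_mult_right)
    from integrable_Re[OF this] integral_Re[OF this]
    show "integrable M R" "(\<integral>x. R x \<partial>M) = Re (cnj (c i) * z)"
      unfolding R_def z_def integral_mult_right_zero by (simp_all only:)
  qed
  have "(\<integral>x. (cmod (f' x))\<^sup>2 \<partial>M)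
      = (\<integral>x. (cmod (f x))\<^sup>2 \<partial>M) - 2 * Re (cnj (c i) * z) + (cmod (c i))\<^sup>2"
    unfolding pointwise R_eq[symmetric] using int2 R_int prob_space by simp
  moreover have "2 * Re (cnj (c i) * z) \<le> (cmod (c i))\<^sup>2 + (cmod z)\<^sup>2"
  proof -
    have "Re (cnj (c i) * z) \<le> cmod (c i) * cmod z"
      using complex_Re_le_cmod[of "cnj (c i) * z"] by (simp add: norm_mult)
    then show ?thesis using sum_squares_bound[of "cmod (c i)" "cmod z"] by simp
  qed
  ultimately have "(\<integral>x. (cmod (f x))\<^sup>2 \<partial>M) - (cmod z)\<^sup>2 \<le> (\<integral>x. (cmod (f' x))\<^sup>2 \<partial>M)" by linarith
  moreover have "(\<integral>x. (cmod (f' x))\<^sup>2 \<partial>M) - (\<Sum>j\<in>S. (cmod (\<integral>x. f' x * cnj (e j x) \<partial>M))\<^sup>2)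
      \<le> (\<integral>x. (cmod (f' x - (\<Sum>j\<in>S. c j * e j x)))\<^sup>2 \<partial>M)"
    using insert.prems(1) B' by (intro insert.IH) auto
  moreover have "(\<Sum>j\<in>S. (cmod (\<integral>x. f' x * cnj (e j x) \<partial>M))\<^sup>2) = (\<Sum>j\<in>S. (cmod (\<integral>x. f x * cnj (e j x) \<partial>M))\<^sup>2)"
    using coeff by simp
  moreover have "f' x - (\<Sum>j\<in>S. c j * e j x) = f x - (\<Sum>j\<in>insert i S. c j * e j x)" for x
    using insert.hyps by (simp add: f'_def)
  ultimately show ?case
    using insert.hyps by (simp add: z_def)
qed

text \<open>The test function is the exponential of frequency \<open>(x, 0)\<close> cut off to the
  first axis. Its squared norm is 1/2 and its squared coefficients are the squared sinc values
  divided by 4, so an error below \<open>\<delta> / 4\<close> becomes the claim after multiplication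
  by 4.\<close>

lemma spectrum_sampling:
  assumes "is_spectrum (rho t) \<Lambda>" "\<delta> > 0"
  obtains S where "finite S" "S \<subseteq> \<Lambda>" "2 - \<delta> < (\<Sum>\<eta>\<in>S. (nsinc (x - fst \<eta>))\<^sup>2)"
proof -
  interpret prob_space "rho t" by (rule prob_space_rho)
  define f :: "real \<times> real \<Rightarrow> complex" where "f p = (if snd p = 0 then expo (x, 0) p else 0)" for p
  have snd_meas [measurable]: "(snd :: real \<times> real \<Rightarrow> real) \<in> borel_measurable borel"
    by (simp add: borel_prod[symmetric])
  have f_meas [measurable]: "f \<in> borel_measurable borel" unfolding f_def by measurable
  have f_rho: "f \<in> borel_measurable (rho t)" using f_meas by (simp cong: measurable_cong_sets)
  have f_le: "cmod (f p) \<le> 1" for p by (simp add: f_def)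
  \<comment> \<open>On the second axis the test function vanishes except at the origin, a null
    set.\<close>
  have vanish: "(LINT s:{t..t+1}|lborel. h s) = 0" if "\<And>s. s \<noteq> 0 \<Longrightarrow> h s = 0"
    for h :: "real \<Rightarrow> 'b::{banach, second_countable_topology}"
    unfolding set_lebesgue_integral_def
    by (rule integral_eq_zero_AE) (use AE_lborel_singleton[of "0::real"] that in auto)
  have norm_f: "(\<integral>p. (cmod (f p))\<^sup>2 \<partial>rho t) = 1/2"
  proof -
    have "(\<integral>p. (cmod (f p))\<^sup>2 \<partial>rho t) = (LINT s:{t..t+1}|lborel. (cmod (f (s, 0)))\<^sup>2) / 2
        + (LINT s:{t..t+1}|lborel. (cmod (f (0, s)))\<^sup>2) / 2"
      using f_le by (intro integral_rho_real[where B = 1]) (auto simp: power_le_one)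
    also have "(LINT s:{t..t+1}|lborel. (cmod (f (0, s)))\<^sup>2) = 0"
      by (rule vanish) (simp add: f_def)
    finally show ?thesis by (simp add: f_def set_lebesgue_integral_def)
  qed
  have coeff: "(cmod (\<integral>p. f p * cnj (expo \<eta> p) \<partial>rho t))\<^sup>2 = (nsinc (x - fst \<eta>))\<^sup>2 / 4" for \<eta>
  proof -
    have e: "f (s, 0) * cnj (expo \<eta> (s, 0))
        = exp (2 * complex_of_real pi * \<i> * complex_of_real ((x - fst \<eta>) * s))" for s
    proof -
      have "f (s, 0) * cnj (expo \<eta> (s, 0)) = expo ((x, 0) - \<eta>) (s, 0)"
        by (simp add: f_def expo_mult_cnj)
      then show ?thesis by (simp add: expo_def inner_prod_def)
    qed
    have "(\<integral>p. f p * cnj (expo \<eta> p) \<partial>rho t) = (LINT s:{t..t+1}|lborel. f (s, 0) * cnj (expo \<eta> (s, 0))) / 2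
        + (LINT s:{t..t+1}|lborel. f (0, s) * cnj (expo \<eta> (0, s))) / 2"
      using f_le by (intro integral_rho[where B = 1]) (auto simp: norm_mult)
    also have "(LINT s:{t..t+1}|lborel. f (0, s) * cnj (expo \<eta> (0, s))) = 0"
      by (rule vanish) (simp add: f_def)
    finally have eq: "(\<integral>p. f p * cnj (expo \<eta> p) \<partial>rho t)
        = cis (pi * ((2 * t + 1) * (x - fst \<eta>))) * of_real (nsinc (x - fst \<eta>)) / 2"
      unfolding e integral_exponential_Icc by simp
    have "cmod (\<integral>p. f p * cnj (expo \<eta> p) \<partial>rho t) = \<bar>nsinc (x - fst \<eta>)\<bar> / 2"
      unfolding eq by (simp add: norm_mult norm_divide)
    then show ?thesis by (simp only: power_divide power2_abs) simp
  qed
  have "integrable (rho t) (\<lambda>p. (cmod (f p))\<^sup>2)"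
    using f_le by (intro integrable_rho_bounded[where B = 1]) (auto simp: power_le_one)
  then have "f \<in> L2_functions (rho t)" using f_rho by (simp add: L2_functions_def)
  moreover have "sqrt (\<delta> / 4) > 0" using assms(2) by simp
  moreover have "exponential_span_dense (rho t) \<Lambda>" using assms(1) by (simp add: is_spectrum_def)
  ultimately obtain S c where S: "finite S" "S \<subseteq> \<Lambda>"
    "L2_seminorm (rho t) (\<lambda>p. f p - (\<Sum>\<xi>\<in>S. c \<xi> * expo \<xi> p)) < sqrt (\<delta> / 4)"
    unfolding exponential_span_dense_def by meson
  have "(\<integral>p. (cmod (f p))\<^sup>2 \<partial>rho t) - (\<Sum>\<eta>\<in>S. (cmod (\<integral>p. f p * cnj (expo \<eta> p) \<partial>rho t))\<^sup>2)
      \<le> (\<integral>p. (cmod (f p - (\<Sum>\<xi>\<in>S. c \<xi> * expo \<xi> p)))\<^sup>2 \<partial>rho t)"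
  proof (rule L2_distance_lower_bound[OF S(1) _ _ _ f_rho f_le])
    show "expo i \<in> borel_measurable (rho t)" for i
      using borel_measurable_expo by (simp cong: measurable_cong_sets)
    show "(\<integral>p. expo i p * cnj (expo j p) \<partial>rho t) = 0" if "i \<in> S" "j \<in> S" "i \<noteq> j" for i j
      using that S(2) assms(1) unfolding is_spectrum_def orthogonal_exponentials_def L2_inner_def by blast
  qed simp
  also have "\<dots> < \<delta> / 4" using S(3) by (simp add: L2_seminorm_def)
  finally have "2 - \<delta> < (\<Sum>\<eta>\<in>S. (nsinc (x - fst \<eta>))\<^sup>2)"
    unfolding norm_f coeff by (simp flip: sum_divide_distrib)
  with S(1,2) show thesis by (rule that)
qed

section \<open>Zeros of the Fourier transform\<close>

lemma abs_nsinc_less_1: "x \<noteq> 0 \<Longrightarrow> \<bar>nsinc x\<bar> < 1"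
  by (rule nsinc_bounded_away[of "\<bar>x\<bar>"]) (auto dest: spec[of _ x] intro: le_less_trans)

text \<open>Two complex numbers with sum 0 have equal modulus, and if they are nonzero their phases
  agree up to sign. The phase condition makes \<open>c * (a - b)\<close> an integer.\<close>

lemma zero_cases:
  assumes zero: "cis (pi * (c * a)) * of_real (nsinc a) + cis (pi * (c * b)) * of_real (nsinc b) = 0"
    and ne: "a \<noteq> 0 \<or> b \<noteq> 0"
  obtains (integer) "a \<in> \<int>" "b \<in> \<int>" "a \<noteq> 0" "b \<noteq> 0"
    | (generic) "a \<notin> \<int>" "b \<notin> \<int>" "a \<noteq> b" "c * (a - b) \<in> \<int>"
        "b * sin (pi * a) + cos (pi * (c * (a - b))) * (a * sin (pi * b)) = 0"
proof (cases "nsinc a = 0")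
  case True
  then have "nsinc b = 0" using zero by simp
  with True integer show thesis by (simp add: nsinc_eq_0_iff)
next
  case False
  let ?\<theta> = "pi * (c * (a - b))"
  \<comment> \<open>Rotating the second summand onto the real axis lets the imaginary part isolate
    \<open>sin ?\<theta>\<close>.\<close>
  have "cis (- (pi * (c * b))) * (cis (pi * (c * a)) * of_real (nsinc a) + cis (pi * (c * b)) * of_real (nsinc b)) = 0"
    using zero by simp
  then have z: "cis ?\<theta> * of_real (nsinc a) + of_real (nsinc b) = 0"
    by (simp add: distrib_left cis_mult right_diff_distrib flip: mult.assoc)
  then have "Im (cis ?\<theta> * of_real (nsinc a) + of_real (nsinc b)) = 0"
    "Re (cis ?\<theta> * of_real (nsinc a) + of_real (nsinc b)) = 0" by simp_all
  then have sin0: "sin ?\<theta> = 0" and re: "cos ?\<theta> * nsinc a + nsinc b = 0"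
    using False by simp_all
  have int: "c * (a - b) \<in> \<int>" using sin0 sin_times_pi_eq_0[of "c * (a - b)"] by (simp add: mult.commute)
  have cos1: "\<bar>cos ?\<theta>\<bar> = 1" using sin0 by (rule sin_zero_abs_cos_one)
  have "nsinc b = - (cos ?\<theta> * nsinc a)" using re by simp
  then have eq: "\<bar>nsinc a\<bar> = \<bar>nsinc b\<bar>" using cos1 by (simp add: abs_mult)
  \<comment> \<open>Only 0 has sinc value of modulus 1, so if one of the two vanished, both
    would.\<close>
  have nz: "a \<noteq> 0" "b \<noteq> 0" using eq ne abs_nsinc_less_1[of a] abs_nsinc_less_1[of b] by auto
  have nonint: "a \<notin> \<int>" "b \<notin> \<int>" using False eq nz nsinc_eq_0_iff[of a] nsinc_eq_0_iff[of b] by auto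
  have "a \<noteq> b" using re False by auto
  have "cos ?\<theta> * cos ?\<theta> = 1" using cos1 by (metis abs_mult_self_eq mult_1)
  then have "nsinc a + cos ?\<theta> * nsinc b = 0" using re by algebra
  then have "b * sin (pi * a) + cos ?\<theta> * (a * sin (pi * b)) = 0"
    using nz by (simp add: nsinc_def field_simps)
  with nonint \<open>a \<noteq> b\<close> int show thesis by (rule generic)
qed

lemma sin_pi_add_Ints:
  assumes "n \<in> \<int>"
  shows "sin (pi * (x + n)) = cos (pi * n) * sin (pi * x)"
  using assms sin_times_pi_eq_0[of n] by (simp add: distrib_left sin_add mult.commute)

theorem theorem1p3:
  fixes t :: real
  assumes "t \<notin> \<rat>"
  shows "\<not> spectral (rho t)"
proof
  assume "spectral (rho t)"
  then obtain \<Lambda> where \<Lambda>: "is_spectrum (rho t) \<Lambda>" by (auto simp: spectral_def)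
  define c where "c = 2 * t + 1"
  have c_irrat: "c \<notin> \<rat>"
  proof
    assume "c \<in> \<rat>"
    then have "(c - 1) / 2 \<in> \<rat>" by (intro Rats_divide Rats_diff) auto
    with assms show False by (simp add: c_def)
  qed
  have int_mult: "n = 0" if "c * n \<in> \<int>" "n \<in> \<int>" for n
  proof (rule ccontr)
    assume "n \<noteq> 0"
    then have "c = (c * n) / n" by simp
    moreover have "(c * n) / n \<in> \<rat>" using that Ints_subset_Rats by (intro Rats_divide) auto
    ultimately show False using c_irrat by simp
  qed
  define generic where "generic \<xi> \<mu> \<longleftrightarrow> fst \<xi> - fst \<mu> \<notin> \<int> \<and> snd \<xi> - snd \<mu> \<notin> \<int>
      \<and> fst \<xi> - fst \<mu> \<noteq> snd \<xi> - snd \<mu> \<and> c * ((fst \<xi> - fst \<mu>) - (snd \<xi> - snd \<mu>)) \<in> \<int>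
      \<and> (snd \<xi> - snd \<mu>) * sin (pi * (fst \<xi> - fst \<mu>)) + cos (pi * (c * ((fst \<xi> - fst \<mu>) - (snd \<xi> - snd \<mu>))))
          * ((fst \<xi> - fst \<mu>) * sin (pi * (snd \<xi> - snd \<mu>))) = 0" for \<xi> \<mu> :: "real \<times> real"
  have dichotomy: "generic \<xi> \<mu> \<or> (fst \<xi> - fst \<mu> \<in> \<int> \<and> snd \<xi> - snd \<mu> \<in> \<int> \<and> fst \<xi> \<noteq> fst \<mu>)"
    if "\<xi> \<in> \<Lambda>" "\<mu> \<in> \<Lambda>" "\<xi> \<noteq> \<mu>" for \<xi> \<mu>
  proof -
    have "L2_inner (rho t) (expo \<xi>) (expo \<mu>) = 0"
      using \<Lambda> that by (simp add: is_spectrum_def orthogonal_exponentials_def)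
    then have z: "cis (pi * (c * (fst \<xi> - fst \<mu>))) * of_real (nsinc (fst \<xi> - fst \<mu>))
      + cis (pi * (c * (snd \<xi> - snd \<mu>))) * of_real (nsinc (snd \<xi> - snd \<mu>)) = 0"
      by (simp add: L2_inner_expo_rho c_def)
    have "fst \<xi> - fst \<mu> \<noteq> 0 \<or> snd \<xi> - snd \<mu> \<noteq> 0" using that(3) by (simp add: prod_eq_iff)
    with z show ?thesis
      by (cases rule: zero_cases) (simp_all add: generic_def)
  qed
  have samp: "\<exists>S. finite S \<and> S \<subseteq> \<Lambda> \<and> 2 - \<delta> < (\<Sum>\<eta>\<in>S. (nsinc (x - fst \<eta>))\<^sup>2)" if "\<delta> > 0" for x \<delta>
    using spectrum_sampling[OF \<Lambda> that] by metis
  have "\<Lambda> \<noteq> {}" using samp[of 1 0] by auto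
  then obtain \<xi>0 where \<xi>0: "\<xi>0 \<in> \<Lambda>" by blast
  \<comment> \<open>Otherwise every other point contributes 0 to the sampling sum at
    \<open>fst \<xi>0\<close>, which is then at most 1 although it must come close to 2.\<close>
  have "\<exists>\<xi>1\<in>\<Lambda>. generic \<xi>0 \<xi>1"
  proof (rule ccontr)
    assume none: "\<not> ?thesis"
    then have "fst \<xi>0 - fst \<mu> \<in> \<int> \<and> fst \<xi>0 \<noteq> fst \<mu>" if "\<mu> \<in> \<Lambda>" "\<mu> \<noteq> \<xi>0" for \<mu>
      using dichotomy[OF \<xi>0 that(1)] that none by blast
    then have zero: "nsinc (fst \<xi>0 - fst \<mu>) = 0" if "\<mu> \<in> \<Lambda>" "\<mu> \<noteq> \<xi>0" for \<mu>
      using that by (simp add: nsinc_eq_0_iff)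
    obtain S where S: "finite S" "S \<subseteq> \<Lambda>" "2 - 1 < (\<Sum>\<eta>\<in>S. (nsinc (fst \<xi>0 - fst \<eta>))\<^sup>2)"
      using samp[of 1 "fst \<xi>0"] by auto
    have "(\<Sum>\<eta>\<in>S. (nsinc (fst \<xi>0 - fst \<eta>))\<^sup>2) = (\<Sum>\<eta>\<in>S \<inter> {\<xi>0}. (nsinc (fst \<xi>0 - fst \<eta>))\<^sup>2)"
      using S zero by (intro sum.mono_neutral_right) auto
    also have "\<dots> \<le> (\<Sum>\<eta>\<in>{\<xi>0}. (nsinc (fst \<xi>0 - fst \<eta>))\<^sup>2)" by (intro sum_mono2) auto
    finally show False using S(3) by simp
  qed
  then obtain \<xi>1 where \<xi>1: "\<xi>1 \<in> \<Lambda>" "generic \<xi>0 \<xi>1" by blast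
  have all_generic: "generic \<xi> \<mu>" if \<xi>\<mu>: "\<xi> \<in> \<Lambda>" "\<mu> \<in> \<Lambda>" "\<xi> \<noteq> \<mu>" for \<xi> \<mu>
  proof (rule ccontr)
    assume "\<not> generic \<xi> \<mu>"
    then have int: "fst \<xi> - fst \<mu> \<in> \<int>" "snd \<xi> - snd \<mu> \<in> \<int>" "fst \<xi> \<noteq> fst \<mu>"
      using dichotomy[OF \<xi>\<mu>] by auto
    \<comment> \<open>An integer difference with both \<open>\<xi>0\<close> and
      \<open>\<xi>1\<close> would make their own difference an integer.\<close>
    have "\<exists>\<nu>\<in>\<Lambda>. fst \<xi> - fst \<nu> \<notin> \<int>"
    proof (rule ccontr)
      assume "\<not> ?thesis"
      then have "fst \<xi> - fst \<xi>1 \<in> \<int>" "fst \<xi> - fst \<xi>0 \<in> \<int>" using \<xi>0 \<xi>1(1) by blast+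
      from Ints_diff[OF this] show False using \<xi>1(2) by (simp add: generic_def)
    qed
    then obtain \<nu> where \<nu>: "\<nu> \<in> \<Lambda>" "fst \<xi> - fst \<nu> \<notin> \<int>" by blast
    have \<mu>\<nu>: "fst \<mu> - fst \<nu> \<notin> \<int>"
    proof
      assume "fst \<mu> - fst \<nu> \<in> \<int>"
      then have "(fst \<xi> - fst \<mu>) + (fst \<mu> - fst \<nu>) \<in> \<int>" using int by (intro Ints_add) auto
      then show False using \<nu>(2) by simp
    qed
    have g: "generic \<xi> \<nu>" "generic \<mu> \<nu>"
      using dichotomy[OF \<xi>\<mu>(1) \<nu>(1)] dichotomy[OF \<xi>\<mu>(2) \<nu>(1)] \<nu>(2) \<mu>\<nu>
      by (metis Ints_0 diff_self)+
    define a b n where "a = fst \<mu> - fst \<nu>" and "b = snd \<mu> - snd \<nu>" and "n = fst \<xi> - fst \<mu>"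
    \<comment> \<open>Both differences to \<open>\<nu>\<close> satisfy the integrality condition.
      With \<open>int_mult\<close> the irrationality of \<open>c\<close> then forces the same
      integer shift \<open>n\<close> in both coordinates.\<close>
    have "c * ((fst \<xi> - fst \<nu>) - (snd \<xi> - snd \<nu>)) - c * ((fst \<mu> - fst \<nu>) - (snd \<mu> - snd \<nu>)) \<in> \<int>"
      using g unfolding generic_def by (intro Ints_diff) auto
    then have "c * ((fst \<xi> - fst \<mu>) - (snd \<xi> - snd \<mu>)) \<in> \<int>" by (simp add: algebra_simps)
    then have "(fst \<xi> - fst \<mu>) - (snd \<xi> - snd \<mu>) = 0" using int by (intro int_mult) auto
    then have ab: "fst \<xi> - fst \<nu> = a + n" "snd \<xi> - snd \<nu> = b + n"
      by (simp_all add: a_def b_def n_def)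
    have n: "n \<in> \<int>" "n \<noteq> 0" using int by (auto simp: n_def)
    \<comment> \<open>The sign is common to both pairs, since a shift of both coordinates by
      \<open>n\<close> preserves \<open>a - b\<close>.\<close>
    define \<kappa> where "\<kappa> = cos (pi * (c * (a - b)))"
    have "cos (pi * n) \<noteq> 0"
      using n(1) sin_times_pi_eq_0[of n] sin_zero_abs_cos_one[of "pi * n"] by (auto simp: mult.commute)
    moreover have "(b + n) * sin (pi * (a + n)) + \<kappa> * ((a + n) * sin (pi * (b + n))) = 0"
      using g(1) by (simp add: generic_def ab \<kappa>_def)
    ultimately have "(b + n) * sin (pi * a) + \<kappa> * ((a + n) * sin (pi * b)) = 0"
      unfolding sin_pi_add_Ints[OF n(1)] by algebra
    moreover have ba: "b * sin (pi * a) + \<kappa> * (a * sin (pi * b)) = 0"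
      using g(2) by (simp add: generic_def a_def b_def \<kappa>_def)
    \<comment> \<open>The two relations differ by \<open>n\<close> times this expression.\<close>
    ultimately have "sin (pi * a) + \<kappa> * sin (pi * b) = 0" using n(2) by algebra
    then have "(b - a) * sin (pi * a) = 0" using ba by algebra
    moreover have "sin (pi * a) \<noteq> 0" using \<mu>\<nu> sin_times_pi_eq_0[of a] by (simp add: a_def mult.commute)
    ultimately show False using g(2) by (simp add: generic_def a_def b_def)
  qed
  have diff_int: "c * ((fst \<xi> - fst \<mu>) - (snd \<xi> - snd \<mu>)) \<in> \<int>" if "\<xi> \<in> \<Lambda>" "\<mu> \<in> \<Lambda>" for \<xi> \<mu>
    using all_generic[OF that] by (cases "\<xi> = \<mu>") (auto simp: generic_def)
  \<comment> \<open>Signs are taken relative to the base point \<open>\<xi>0\<close>. The sign of a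
    difference factorises because the sines in the addition formula vanish.\<close>
  define sg where "sg \<xi> = cos (pi * (c * ((fst \<xi> - fst \<xi>0) - (snd \<xi> - snd \<xi>0))))" for \<xi> :: "real \<times> real"
  have sin0: "sin (pi * (c * ((fst \<xi> - fst \<xi>0) - (snd \<xi> - snd \<xi>0)))) = 0" if "\<xi> \<in> \<Lambda>" for \<xi>
    using diff_int[OF that \<xi>0] sin_times_pi_eq_0 by (metis mult.commute)
  have sg_mult: "cos (pi * (c * ((fst \<xi> - fst \<mu>) - (snd \<xi> - snd \<mu>)))) = sg \<xi> * sg \<mu>"
    if "\<xi> \<in> \<Lambda>" "\<mu> \<in> \<Lambda>" for \<xi> \<mu>
  proof -
    have "pi * (c * ((fst \<xi> - fst \<mu>) - (snd \<xi> - snd \<mu>)))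
       = pi * (c * ((fst \<xi> - fst \<xi>0) - (snd \<xi> - snd \<xi>0))) - pi * (c * ((fst \<mu> - fst \<xi>0) - (snd \<mu> - snd \<xi>0)))"
      by (simp add: algebra_simps)
    then show ?thesis unfolding sg_def using sin0 that by (simp add: cos_diff)
  qed
  interpret twisted_set \<Lambda> c sg
  proof
    show "c \<noteq> 0" using c_irrat by auto
    show "(sg \<xi>)\<^sup>2 = 1" if "\<xi> \<in> \<Lambda>" for \<xi>
      \<comment> \<open>For equal points the cosine is \<open>cos 0 = 1\<close>.\<close>
      using sg_mult[OF that that] by (simp add: power2_eq_square)
    fix \<xi> \<mu> assume *: "\<xi> \<in> \<Lambda>" "\<mu> \<in> \<Lambda>"
    show "c * ((fst \<xi> - fst \<mu>) - (snd \<xi> - snd \<mu>)) \<in> \<int>" using * by (rule diff_int)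
    show "(snd \<xi> - snd \<mu>) * sin (pi * (fst \<xi> - fst \<mu>))
        + sg \<xi> * sg \<mu> * ((fst \<xi> - fst \<mu>) * sin (pi * (snd \<xi> - snd \<mu>))) = 0"
      using all_generic[OF *] by (cases "\<xi> = \<mu>") (auto simp: generic_def sg_mult[OF *])
    assume "\<xi> \<noteq> \<mu>"
    then show "fst \<xi> - fst \<mu> \<notin> \<int>" "snd \<xi> - snd \<mu> \<notin> \<int>" "fst \<xi> - fst \<mu> \<noteq> snd \<xi> - snd \<mu>"
      using all_generic[OF *] by (auto simp: generic_def)
  qed
  from samp show False by (rule sampling_deficient)
qed

end
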